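(* For any RES-graph $(G,\gamma,b)$, $$\tilde{\nu}(G,\gamma,b)=\min_{\gamma',X}\Big(\gamma'(E(X))+\tfrac12|\delta(X)|-\mathrm{odd}_{\gamma'}(G-X)\Big),$$ where the minimum is taken over all shiftings $\gamma'$ of $\gamma$ and all sets of vertices $X\subseteq V(G)$ with $b\in X$.
   Context: Graphs are finite and may have loops and multiple edges. Each edge consists of two half-edges; each half-edge is incident to a vertex, and a loop has both half-edges at the same vertex, so it contributes $2$ to that vertex's degree. An arc is an ordered pair $(h_1,h_2)$ of half-edges forming an edge; its tail is the vertex of $h_1$ and its head is the vertex of $h_2$. A trail is a sequence of arcs whose edges are pairwise distinct and such that the head of each arc (other than the last) is the tail of the next. Its tail is the tail of its first arc, and its head is the head of its last arc. A circuit is a trail whose head equals its tail. A circuit hits a vertex $v$ if it contains an arc incident to $v$. A circuit-decomposition of $G$ is a collection of circuits such that every edge of $G$ is used by exactly one circuit of the collection. A graph is Eulerian if it is connected and every vertex has even degree. A signature of $G$ is a function $\gamma:E(G)\to\mathbb{Z}_2$. The weight of a trail is the sum in $\mathbb{Z}_2$ of $\gamma$ over its edges, and a trail (or edge) is zero or non-zero according to its weight. Shifting at a vertex $v$ means adding $1$ to the weight of every non-loop edge incident to $v$. A shifting of $\gamma$ is any signature obtainable from $\gamma$ by a sequence of shiftings at vertices. An RES-graph is a triple $(G,\gamma,b)$ where $G$ is an Eulerian graph, $\gamma$ is a signature of $G$, and $b\in V(G)$ is called the root. The flooding number $\tilde{\nu}(G,\gamma,b)$ is the maximum size of a circuit-decomposition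 of $G$ in which every circuit is non-zero and hits $b$; it is $0$ if no such decomposition exists. For $X\subseteq V(G)$, $E(X)$ is the set of edges with both ends in $X$, and $\delta(X)$ is the set of edges with exactly one end in $X$. $G-X$ is the subgraph induced on $V(G)\setminus X$. For a set of edges $F$ and a signature $\gamma'$, $\gamma'(F)$ denotes the number of edges of $F$ with weight $1$ under $\gamma'$. A vertex set $Y$ is $\gamma'$-odd if the parity of $\gamma'(E(Y)\cup\delta(Y))$ differs from the parity of $|\delta(Y)|/2$. Finally, $\mathrm{odd}_{\gamma'}(G-X)$ is the number of components of $G-X$ whose vertex set is $\gamma'$-odd. *)

theory Defs
  imports Main
begin

text \<open>A finite graph with loops and multiple edges is given by a vertex set V,
an edge set E and a map ends :: edge => vertex * vertex.  Edge e consists of two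
half-edges: the first at fst (ends e), the second at snd (ends e).
A loop is an edge with fst (ends e) = snd (ends e).
An arc is a pair (e, d): for d = True it is (h1,h2), for d = False it is (h2,h1).
Signatures are maps E -> Z_2, represented as 'e => bool (True = 1).\<close>

definition graph :: "'v set \<Rightarrow> 'e set \<Rightarrow> ('e \<Rightarrow> 'v \<times> 'v) \<Rightarrow> bool" where
  "graph V E ends \<longleftrightarrow> finite V \<and> finite E \<and> (\<forall>e\<in>E. fst (ends e) \<in> V \<and> snd (ends e) \<in> V)"

definition degree :: "'e set \<Rightarrow> ('e \<Rightarrow> 'v \<times> 'v) \<Rightarrow> 'v \<Rightarrow> nat" where
  "degree E ends v = card {e\<in>E. fst (ends e) = v} + card {e\<in>E. snd (ends e) = v}"

text \<open>Adjacency via edges of E whose both ends lie in S.\<close>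
definition adj_in :: "'v set \<Rightarrow> 'e set \<Rightarrow> ('e \<Rightarrow> 'v \<times> 'v) \<Rightarrow> ('v \<times> 'v) set" where
  "adj_in S E ends = {(x, y). x \<in> S \<and> y \<in> S \<and> (\<exists>e\<in>E. ends e = (x, y) \<or> ends e = (y, x))}"

definition connected_graph :: "'v set \<Rightarrow> 'e set \<Rightarrow> ('e \<Rightarrow> 'v \<times> 'v) \<Rightarrow> bool" where
  "connected_graph V E ends \<longleftrightarrow> V \<noteq> {} \<and> (\<forall>u\<in>V. \<forall>v\<in>V. (u, v) \<in> (adj_in V E ends)\<^sup>*)"

definition eulerian :: "'v set \<Rightarrow> 'e set \<Rightarrow> ('e \<Rightarrow> 'v \<times> 'v) \<Rightarrow> bool" where
  "eulerian V E ends \<longleftrightarrow> graph V E ends \<and> connected_graph V E ends \<and> (\<forall>v\<in>V. even (degree E ends v))"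

definition arc_tail :: "('e \<Rightarrow> 'v \<times> 'v) \<Rightarrow> 'e \<times> bool \<Rightarrow> 'v" where
  "arc_tail ends a = (if snd a then fst (ends (fst a)) else snd (ends (fst a)))"

definition arc_head :: "('e \<Rightarrow> 'v \<times> 'v) \<Rightarrow> 'e \<times> bool \<Rightarrow> 'v" where
  "arc_head ends a = (if snd a then snd (ends (fst a)) else fst (ends (fst a)))"

text \<open>A trail: a nonempty sequence of arcs of G with pairwise distinct edges, head of each
arc equal to the tail of the next.\<close>
definition trail :: "'e set \<Rightarrow> ('e \<Rightarrow> 'v \<times> 'v) \<Rightarrow> ('e \<times> bool) list \<Rightarrow> bool" where
  "trail E ends t \<longleftrightarrow> t \<noteq> [] \<and> set (map fst t) \<subseteq> E \<and> distinct (map fst t) \<and>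
     (\<forall>i. Suc i < length t \<longrightarrow> arc_head ends (t ! i) = arc_tail ends (t ! Suc i))"

definition circuit :: "'e set \<Rightarrow> ('e \<Rightarrow> 'v \<times> 'v) \<Rightarrow> ('e \<times> bool) list \<Rightarrow> bool" where
  "circuit E ends t \<longleftrightarrow> trail E ends t \<and> arc_head ends (last t) = arc_tail ends (hd t)"

definition hits :: "('e \<Rightarrow> 'v \<times> 'v) \<Rightarrow> ('e \<times> bool) list \<Rightarrow> 'v \<Rightarrow> bool" where
  "hits ends t v \<longleftrightarrow> (\<exists>a\<in>set t. arc_tail ends a = v \<or> arc_head ends a = v)"

text \<open>Weight of a trail in Z_2: True iff an odd number of its edges have weight 1.\<close>
definition nonzero_trail :: "('e \<Rightarrow> bool) \<Rightarrow> ('e \<times> bool) list \<Rightarrow> bool" where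
  "nonzero_trail \<gamma> t \<longleftrightarrow> odd (card {e \<in> set (map fst t). \<gamma> e})"

text \<open>A circuit decomposition: a collection (list) of circuits such that every edge of G
is used by exactly one circuit of the collection.\<close>
definition circuit_decomposition :: "'e set \<Rightarrow> ('e \<Rightarrow> 'v \<times> 'v) \<Rightarrow> ('e \<times> bool) list list \<Rightarrow> bool" where
  "circuit_decomposition E ends C \<longleftrightarrow> (\<forall>c\<in>set C. circuit E ends c) \<and>
     (\<forall>e\<in>E. \<exists>!i. i < length C \<and> e \<in> set (map fst (C ! i)))"

definition flooding_number :: "'v set \<Rightarrow> 'e set \<Rightarrow> ('e \<Rightarrow> 'v \<times> 'v) \<Rightarrow> ('e \<Rightarrow> bool) \<Rightarrow> 'v \<Rightarrow> nat" where
  "flooding_number V E ends \<gamma> b =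
     (let S = {length C | C. circuit_decomposition E ends C \<and>
                 (\<forall>c\<in>set C. nonzero_trail \<gamma> c \<and> hits ends c b)}
      in if S = {} then 0 else Max S)"

text \<open>Shifting at v: add 1 to the weight of every non-loop edge incident to v.\<close>
definition shift_at :: "'e set \<Rightarrow> ('e \<Rightarrow> 'v \<times> 'v) \<Rightarrow> 'v \<Rightarrow> ('e \<Rightarrow> bool) \<Rightarrow> ('e \<Rightarrow> bool)" where
  "shift_at E ends v \<gamma> = (\<lambda>e. if e \<in> E \<and> fst (ends e) \<noteq> snd (ends e) \<and> (fst (ends e) = v \<or> snd (ends e) = v)
                               then \<not> \<gamma> e else \<gamma> e)"

inductive is_shifting :: "'v set \<Rightarrow> 'e set \<Rightarrow> ('e \<Rightarrow> 'v \<times> 'v) \<Rightarrow> ('e \<Rightarrow> bool) \<Rightarrow> ('e \<Rightarrow> bool) \<Rightarrow> bool"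
  for V E ends \<gamma> where
  refl: "is_shifting V E ends \<gamma> \<gamma>"
| step: "is_shifting V E ends \<gamma> \<gamma>' \<Longrightarrow> v \<in> V \<Longrightarrow> is_shifting V E ends \<gamma> (shift_at E ends v \<gamma>')"

definition E_in :: "'e set \<Rightarrow> ('e \<Rightarrow> 'v \<times> 'v) \<Rightarrow> 'v set \<Rightarrow> 'e set" where
  "E_in E ends X = {e\<in>E. fst (ends e) \<in> X \<and> snd (ends e) \<in> X}"

definition delta :: "'e set \<Rightarrow> ('e \<Rightarrow> 'v \<times> 'v) \<Rightarrow> 'v set \<Rightarrow> 'e set" where
  "delta E ends X = {e\<in>E. (fst (ends e) \<in> X) \<noteq> (snd (ends e) \<in> X)}"

text \<open>gamma'(F): number of edges of F of weight 1.\<close>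
definition wcount :: "('e \<Rightarrow> bool) \<Rightarrow> 'e set \<Rightarrow> nat" where
  "wcount \<gamma> F = card {e\<in>F. \<gamma> e}"

definition gamma_odd :: "'e set \<Rightarrow> ('e \<Rightarrow> 'v \<times> 'v) \<Rightarrow> ('e \<Rightarrow> bool) \<Rightarrow> 'v set \<Rightarrow> bool" where
  "gamma_odd E ends \<gamma> Y \<longleftrightarrow>
     odd (wcount \<gamma> (E_in E ends Y \<union> delta E ends Y)) \<noteq> odd (card (delta E ends Y) div 2)"

text \<open>Vertex sets of the components of G - X (the subgraph induced on V - X).\<close>
definition components_minus :: "'v set \<Rightarrow> 'e set \<Rightarrow> ('e \<Rightarrow> 'v \<times> 'v) \<Rightarrow> 'v set \<Rightarrow> 'v set set" where
  "components_minus V E ends X =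
     (\<lambda>u. {w. (u, w) \<in> (adj_in (V - X) E ends)\<^sup>*}) ` (V - X)"

definition odd_components :: "'v set \<Rightarrow> 'e set \<Rightarrow> ('e \<Rightarrow> 'v \<times> 'v) \<Rightarrow> ('e \<Rightarrow> bool) \<Rightarrow> 'v set \<Rightarrow> nat" where
  "odd_components V E ends \<gamma> X = card {Y \<in> components_minus V E ends X. gamma_odd E ends \<gamma> Y}"

end

theory Submission
  imports Defs
begin

text \<open>
Give every half-edge a sign, opposite at the two ends of a zero edge and equal at the two ends of a
non-zero edge. If the signs alternate whenever a circuit passes a vertex, then the circuit is
non-zero iff its first and last signs agree. Hence the flooding number is half the largest imbalance
of signs at \<open>b\<close> over all signings that are balanced at every other vertex: closed alternating
trails are zero, so by connectivity they can be inserted into the circuits through \<open>b\<close>.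

The realisable imbalance vectors form a constant-parity jump system, which makes an argument in the
style of Gallai's lemma available. Take a shifting and a set \<open>X\<close> containing \<open>b\<close> such that contracting
\<open>X\<close> to \<open>b\<close> does not raise the maximum, with \<open>X\<close> maximal. An optimal signing then has positive signs
on all non-zero edges inside \<open>X\<close>, and each component of \<open>G - X\<close> has at most one edge to \<open>X\<close> whose sign
at \<open>X\<close> is negative. Modulo 4, the number of such edges of a component is odd iff the component is
odd, so \<open>X\<close> attains the bound.
\<close>

section \<open>Signings and the jump system of imbalances\<close>

text \<open>Shifting at a vertex amounts to reversing all half-edge signs there, and contracting
  \<open>X\<close> to \<open>b\<close> adds up the imbalances of \<open>X\<close>. Neither lowers
  the maximal root imbalance, so every pair of a shifting and a set bounds it from above. Twice the
  value in the formula is the sum of the signs of all half-edges in \<open>X\<close> when these are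
  as favourable as the parity of each component allows. The obstacle is that a vertex paying for a
  gain at the root pays with a sign, unlike a vertex missed by a matching. A vertex that can pay
  with one sign only is harmless: after a shift, if needed, it pays with a negative imbalance, and
  merging it into the root cancels the gain against the payment. Hence maximality of
  \<open>X\<close> leaves outside \<open>X\<close> only vertices that can pay with both signs or
  with none, and for those that can pay with both signs, being unable to pay jointly is transitive
  and holds across edges. The last point needs more than the jump axiom for vectors: the sign of the
  connecting edge must stay fixed during an exchange, so the jump lemma also records which edges
  keep their signs.\<close>

definition signing :: "('e \<Rightarrow> int) \<Rightarrow> bool" where
  "signing x \<longleftrightarrow> (\<forall>e. x e = 1 \<or> x e = -1)"

text \<open>\<open>x e\<close> is the sign of the half-edge at \<open>fst (ends e)\<close>; the
  other half-edge gets \<open>x e\<close> or \<open>- x e\<close> according to the weight of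
  \<open>e\<close>. One free sign per edge thus encodes a signing of all half-edges, and an arc
  reads off the signs at its two ends.\<close>

definition tail_sign :: "('e \<Rightarrow> bool) \<Rightarrow> ('e \<Rightarrow> int) \<Rightarrow> 'e \<times> bool \<Rightarrow> int" where
  "tail_sign \<gamma> x a = (if snd a \<or> \<gamma> (fst a) then x (fst a) else - x (fst a))"

definition head_sign :: "('e \<Rightarrow> bool) \<Rightarrow> ('e \<Rightarrow> int) \<Rightarrow> 'e \<times> bool \<Rightarrow> int" where
  "head_sign \<gamma> x a = (if \<not> snd a \<or> \<gamma> (fst a) then x (fst a) else - x (fst a))"

text \<open>Steps of the jump system are sums of \<open>point\<close> terms rather than function
  updates, so that steps at coinciding vertices, such as the two ends of a loop, simply add
  up.\<close>

definition point :: "'v \<Rightarrow> int \<Rightarrow> 'v \<Rightarrow> int" where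
  "point v c = (\<lambda>u. if u = v then c else 0)"

definition imbalance ::
  "'e set \<Rightarrow> ('e \<Rightarrow> 'v \<times> 'v) \<Rightarrow> ('e \<Rightarrow> bool) \<Rightarrow> ('e \<Rightarrow> int) \<Rightarrow> 'v \<Rightarrow> int" where
  "imbalance E ends \<gamma> x v =
     (\<Sum>e\<in>E. point (fst (ends e)) (x e) v + point (snd (ends e)) (if \<gamma> e then x e else - x e) v)"

definition feasible ::
  "'e set \<Rightarrow> ('e \<Rightarrow> 'v \<times> 'v) \<Rightarrow> ('e \<Rightarrow> bool) \<Rightarrow> ('v \<Rightarrow> int) \<Rightarrow> bool" where
  "feasible E ends \<gamma> s \<longleftrightarrow> (\<exists>x. signing x \<and> imbalance E ends \<gamma> x = s)"

lemma signing_flip: "signing x \<Longrightarrow> signing (x(e := - x e))"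
  by (fastforce simp: signing_def)

lemma tail_sign_cases: "signing x \<Longrightarrow> tail_sign \<gamma> x a = 1 \<or> tail_sign \<gamma> x a = -1"
  by (fastforce simp: signing_def tail_sign_def)

lemma head_sign_eq: "head_sign \<gamma> x a = (if \<gamma> (fst a) then tail_sign \<gamma> x a else - tail_sign \<gamma> x a)"
  by (auto simp: tail_sign_def head_sign_def)

lemma tail_sign_flip: "fst a = e \<Longrightarrow> tail_sign \<gamma> (x(e := - x e)) a = - tail_sign \<gamma> x a"
  by (auto simp: tail_sign_def)

lemma tail_sign_eq_iff:
  "tail_sign \<gamma> x a = tail_sign \<gamma> y a \<longleftrightarrow> x (fst a) = y (fst a)"
  by (auto simp: tail_sign_def)

lemma end_signs_arc:
  "point (fst (ends (fst a))) (x (fst a)) u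
     + point (snd (ends (fst a))) (if \<gamma> (fst a) then x (fst a) else - x (fst a)) u
   = point (arc_tail ends a) (tail_sign \<gamma> x a) u + point (arc_head ends a) (head_sign \<gamma> x a) u"
  by (auto simp: tail_sign_def head_sign_def arc_tail_def arc_head_def)

lemma imbalance_uminus: "imbalance E ends \<gamma> (\<lambda>e. - x e) v = - imbalance E ends \<gamma> x v"
  by (auto simp: imbalance_def point_def sum_negf[symmetric] intro!: sum.cong)

section \<open>The jump axiom for imbalance vectors\<close>

locale signed_graph =
  fixes E :: "'e set" and ends :: "'e \<Rightarrow> 'v \<times> 'v" and \<gamma> :: "'e \<Rightarrow> bool"
  assumes finite_edges: "finite E"
begin

abbreviation "imb \<equiv> imbalance E ends \<gamma>"
abbreviation "feas \<equiv> feasible E ends \<gamma>"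

text \<open>The elementary move behind all exchanges: reversing an edge reverses both of its
  half-edges, which is one step of length 2 at each end.\<close>

lemma imb_flip:
  assumes "fst a \<in> E"
  shows "imb (x(fst a := - x (fst a))) =
    (\<lambda>u. imb x u - point (arc_tail ends a) (2 * tail_sign \<gamma> x a) u
               - point (arc_head ends a) (2 * head_sign \<gamma> x a) u)"
proof
  fix u
  let ?c = "\<lambda>y e. point (fst (ends e)) (y e) u + point (snd (ends e)) (if \<gamma> e then y e else - y e) u"
  let ?y = "x(fst a := - x (fst a))"
  have split: "A = B - 2 * c" if "A = - c + (B - c)" for A B c :: int
    using that by simp
  have "imb ?y u = ?c ?y (fst a) + (\<Sum>e\<in>E - {fst a}. ?c ?y e)"
    unfolding imbalance_def by (rule sum.remove[OF finite_edges assms])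
  also have "(\<Sum>e\<in>E - {fst a}. ?c ?y e) = (\<Sum>e\<in>E - {fst a}. ?c x e)"
    by (rule sum.cong) auto
  also have "?c ?y (fst a) = - ?c x (fst a)"
    by (auto simp: point_def)
  also have "(\<Sum>e\<in>E - {fst a}. ?c x e) = imb x u - ?c x (fst a)"
    unfolding imbalance_def by (subst sum.remove[OF finite_edges assms]) simp
  finally have "imb ?y u = imb x u - 2 * ?c x (fst a)"
    by (rule split)
  then show "imb ?y u = imb x u - point (arc_tail ends a) (2 * tail_sign \<gamma> x a) u
               - point (arc_head ends a) (2 * head_sign \<gamma> x a) u"
    unfolding end_signs_arc by (simp only: point_def) (auto split: if_splits)
qed

lemma imb_diff_even:
  assumes "signing x" "signing y"
  shows "even (imb y v - imb x v)"
  unfolding imbalance_def sum_subtractf[symmetric]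
proof (rule dvd_sum)
  fix e assume "e \<in> E"
  have "x e = 1 \<or> x e = -1" "y e = 1 \<or> y e = -1"
    using assms by (auto simp: signing_def)
  then show "even (point (fst (ends e)) (y e) v + point (snd (ends e)) (if \<gamma> e then y e else - y e) v
    - (point (fst (ends e)) (x e) v + point (snd (ends e)) (if \<gamma> e then x e else - x e) v))"
    by (auto simp: point_def)
qed

lemma feas_diff_even: "feas s \<Longrightarrow> feas s' \<Longrightarrow> even (s' v - s v)"
  using imb_diff_even by (auto simp: feasible_def)

text \<open>Feasible vectors form a constant-parity jump system. If the second step of a flipped edge
leads away from the target, undo it as the first step of the next round.\<close>

lemma jump:
  assumes "signing x" "signing y" "\<tau> = 1 \<or> \<tau> = -1" "\<tau> * (imb y v - imb x v) > 0"
  shows "\<exists>z w \<rho>. signing z \<and> (\<rho> = 1 \<or> \<rho> = -1) \<and>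
    imb z = (\<lambda>u. imb x u + point v (2 * \<tau>) u + point w (2 * \<rho>) u) \<and>
    \<rho> * (imb y w - imb x w - point v (2 * \<tau>) w) > 0 \<and> (\<forall>e. x e = y e \<longrightarrow> z e = x e)"
  using assms
proof (induction "card {e \<in> E. x e \<noteq> y e}" arbitrary: x v \<tau> rule: less_induct)
  case less
  let ?c = "\<lambda>y e. point (fst (ends e)) (y e) v + point (snd (ends e)) (if \<gamma> e then y e else - y e) v"
  have "0 < (\<Sum>e\<in>E. \<tau> * (?c y e - ?c x e))"
    using less.prems(4) by (simp add: imbalance_def sum_distrib_left sum_subtractf algebra_simps)
  then have "\<exists>e\<in>E. 0 < \<tau> * (?c y e - ?c x e)"
    by (meson not_less sum_nonpos)
  then obtain e where e: "e \<in> E" "0 < \<tau> * (?c y e - ?c x e)" by blast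
  have pm: "x e = 1 \<or> x e = -1" "y e = 1 \<or> y e = -1"
    using less.prems by (auto simp: signing_def)
  have ne: "x e \<noteq> y e"
  proof
    assume "x e = y e"
    then show False using e(2) by (simp cong: if_cong)
  qed
  then have ye: "y e = - x e" using pm by auto
  \<comment> \<open>Some half-edge of \<open>e\<close> at \<open>v\<close> must change in direction
    \<open>\<tau>\<close>; \<open>a\<close> directs \<open>e\<close> away from that half-edge, so
    that reversing it supplies the first step.\<close>
  obtain a where a: "fst a = e" "arc_tail ends a = v" "tail_sign \<gamma> x a = - \<tau>"
  proof (cases "fst (ends e) = v \<and> x e = - \<tau>")
    case True
    then show ?thesis using that[of "(e, True)"] by (simp add: arc_tail_def tail_sign_def)
  next
    case False
    then have "snd (ends e) = v \<and> (if \<gamma> e then x e else - x e) = - \<tau>"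
      using e(2) less.prems(3) pm ye by (auto simp: point_def split: if_splits)
    then have "arc_tail ends (e, False) = v" "tail_sign \<gamma> x (e, False) = - \<tau>"
      by (auto simp: arc_tail_def tail_sign_def split: if_splits)
    then show ?thesis using that[of "(e, False)"] by simp
  qed
  define w where "w = arc_head ends a"
  define \<rho> where "\<rho> = - head_sign \<gamma> x a"
  have \<rho>: "\<rho> = 1 \<or> \<rho> = -1"
    using a(3) less.prems(3) by (auto simp: \<rho>_def head_sign_eq)
  let ?x = "x(e := - x e)"
  have imb1: "imb ?x = (\<lambda>u. imb x u + point v (2 * \<tau>) u + point w (2 * \<rho>) u)"
    using imb_flip[of a x] e(1) a by (auto simp: w_def \<rho>_def point_def)
  have sx: "signing ?x" using less.prems(1) by (rule signing_flip)
  show ?case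
  proof (cases "\<rho> * (imb y w - imb x w - point v (2 * \<tau>) w) > 0")
    case True
    have agree: "\<forall>f. x f = y f \<longrightarrow> ?x f = x f"
      using ne by simp
    show ?thesis
      by (rule exI[of _ ?x], rule exI[of _ w], rule exI[of _ \<rho>])
        (intro conjI sx \<rho> imb1 True agree)
  next
    case False
    have "{f \<in> E. ?x f \<noteq> y f} \<subset> {f \<in> E. x f \<noteq> y f}"
    proof (rule psubsetI)
      show "{f \<in> E. ?x f \<noteq> y f} \<subseteq> {f \<in> E. x f \<noteq> y f}"
        using ne by auto
      have "e \<in> {f \<in> E. x f \<noteq> y f}" "e \<notin> {f \<in> E. ?x f \<noteq> y f}"
        using e(1) ne ye by simp_all
      then show "{f \<in> E. ?x f \<noteq> y f} \<noteq> {f \<in> E. x f \<noteq> y f}" by metis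
    qed
    then have "card {f \<in> E. ?x f \<noteq> y f} < card {f \<in> E. x f \<noteq> y f}"
      using finite_edges by (intro psubset_card_mono) auto
    moreover have "(- \<rho>) * (imb y w - imb ?x w) > 0"
      using False \<rho> unfolding imb1 by (auto simp: point_def)
    moreover have "- \<rho> = 1 \<or> - \<rho> = -1"
      using \<rho> by linarith
    ultimately have "\<exists>z w' \<rho>'. signing z \<and> (\<rho>' = 1 \<or> \<rho>' = -1) \<and>
      imb z = (\<lambda>u. imb ?x u + point w (2 * (- \<rho>)) u + point w' (2 * \<rho>') u) \<and>
      \<rho>' * (imb y w' - imb ?x w' - point w (2 * (- \<rho>)) w') > 0 \<and>
      (\<forall>f. ?x f = y f \<longrightarrow> z f = ?x f)"
      by (intro less.hyps[OF _ sx less.prems(2)])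
    then obtain z w' \<rho>' where z: "signing z" "\<rho>' = 1 \<or> \<rho>' = -1"
      "imb z = (\<lambda>u. imb ?x u + point w (2 * (- \<rho>)) u + point w' (2 * \<rho>') u)"
      "\<rho>' * (imb y w' - imb ?x w' - point w (2 * (- \<rho>)) w') > 0"
      "\<forall>f. ?x f = y f \<longrightarrow> z f = ?x f"
      by blast
    have r1: "imb z = (\<lambda>u. imb x u + point v (2 * \<tau>) u + point w' (2 * \<rho>') u)"
      unfolding z(3) imb1 by (auto simp: point_def)
    have r2: "\<rho>' * (imb y w' - imb x w' - point v (2 * \<tau>) w') > 0"
      using z(4) unfolding imb1 by (auto simp: point_def algebra_simps split: if_splits)
    have r3: "\<forall>f. x f = y f \<longrightarrow> z f = x f"
      using z(5) ne by (metis fun_upd_other)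
    show ?thesis
      by (rule exI[of _ z], rule exI[of _ w'], rule exI[of _ \<rho>'])
        (intro conjI z(1,2) r1 r2 r3)
  qed
qed

text \<open>The last conclusion goes beyond the usual two-step axiom: an edge on which
  \<open>x\<close> and \<open>y\<close> agree keeps its sign. It serves to hold one chosen edge
  fixed during an exchange.\<close>

lemma jumpE:
  assumes "signing x" "signing y" "\<tau> = 1 \<or> \<tau> = -1" "\<tau> * (imb y v - imb x v) > 0"
  obtains z w \<rho> where "signing z" "\<rho> = 1 \<or> \<rho> = -1"
    "imb z = (\<lambda>u. imb x u + point v (2 * \<tau>) u + point w (2 * \<rho>) u)"
    "\<rho> * (imb y w - imb x w - point v (2 * \<tau>) w) > 0" "\<forall>e. x e = y e \<longrightarrow> z e = x e"
  using jump[OF assms] by blast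

lemma feas_jump:
  assumes "feas s" "feas s'" "\<tau> = 1 \<or> \<tau> = -1" "\<tau> * (s' v - s v) > 0"
  obtains w \<rho> where "\<rho> = 1 \<or> \<rho> = -1"
    "feas (\<lambda>u. s u + point v (2 * \<tau>) u + point w (2 * \<rho>) u)"
    "\<rho> * (s' w - s w - point v (2 * \<tau>) w) > 0"
proof -
  obtain x y where xy: "signing x" "imb x = s" "signing y" "imb y = s'"
    using assms(1,2) by (auto simp: feasible_def)
  then show ?thesis
    using jump[OF xy(1,3) assms(3), of v] assms(4) that by (auto simp: feasible_def)
qed

end

section \<open>Exchanges at the maximal root imbalance, after Gallai\<close>

locale rooted_signed_graph = signed_graph E ends \<gamma>
  for E :: "'e set" and ends :: "'e \<Rightarrow> 'v \<times> 'v" and \<gamma> :: "'e \<Rightarrow> bool" +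
  fixes r :: 'v and k :: int
  assumes feas_root: "feas (point r k)"
    and root_max: "feas (point r j) \<Longrightarrow> j \<le> k"
begin

text \<open>\<open>k\<close> is the maximal root imbalance. A critical pair \<open>(v, \<tau>)\<close> is one at which an imbalance \<open>2\<tau>\<close> can be
traded for a gain of 2 at the root; \<open>\<not> joint\<close> plays the role of the relation
``no maximum matching misses both'' in Gallai's lemma.\<close>

definition critical :: "'v \<Rightarrow> int \<Rightarrow> bool" where
  "critical v \<tau> \<longleftrightarrow> feas (\<lambda>u. point r (k + 2) u + point v (2 * \<tau>) u)"

definition joint :: "'v \<Rightarrow> int \<Rightarrow> 'v \<Rightarrow> int \<Rightarrow> bool" where
  "joint v \<tau> w \<rho> \<longleftrightarrow> feas (\<lambda>u. point r (k + 4) u + point v (2 * \<tau>) u + point w (2 * \<rho>) u)"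

lemma not_feas_above: "j > k \<Longrightarrow> s = point r j \<Longrightarrow> \<not> feas s"
  using root_max by fastforce

lemma joint_commute: "joint v \<tau> w \<rho> \<longleftrightarrow> joint w \<rho> v \<tau>"
  by (simp add: joint_def algebra_simps)

lemma not_joint_opposite: "\<not> joint v \<tau> v (- \<tau>)"
  unfolding joint_def by (rule not_feas_above[of "k + 4"]) (auto simp: point_def)

text \<open>Jump from the critical vector of \<open>u\<close> towards the joint vector, starting
  with the missing 2 at the root. The second step cannot cancel the payment at \<open>u\<close>,
  since root imbalance \<open>k + 4\<close> alone is infeasible; so it is the payment at
  \<open>v\<close> or at \<open>w\<close>.\<close>

lemma joint_exchange:
  assumes "joint v \<tau> w \<rho>" "critical u \<mu>" "v \<noteq> r" "w \<noteq> r" "u \<noteq> r"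
    and pm: "\<tau> = 1 \<or> \<tau> = -1" "\<rho> = 1 \<or> \<rho> = -1" "\<mu> = 1 \<or> \<mu> = -1"
  shows "joint v \<tau> u \<mu> \<or> joint w \<rho> u \<mu>"
proof -
  obtain q \<sigma> where q: "\<sigma> = 1 \<or> \<sigma> = -1"
    "feas (\<lambda>y. point r (k + 2) y + point u (2 * \<mu>) y + point r (2 * 1) y + point q (2 * \<sigma>) y)"
    "\<sigma> * (point r (k + 4) q + point v (2 * \<tau>) q + point w (2 * \<rho>) q -
       (point r (k + 2) q + point u (2 * \<mu>) q) - point r (2 * 1) q) > 0"
    using assms(3-5)
    by (rule_tac feas_jump[OF assms(2)[unfolded critical_def] assms(1)[unfolded joint_def], of 1 r])
      (auto simp: point_def)
  have q2: "feas (\<lambda>y. point r (k + 4) y + point q (2 * \<sigma>) y + point u (2 * \<mu>) y)"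
    using q(2) by (rule back_subst[of feas]) (auto simp: point_def)
  have "q \<noteq> u \<or> \<sigma> \<noteq> - \<mu>"
    using q2 not_joint_opposite[of u "- \<mu>"] by (auto simp: joint_def)
  then have "(q = v \<and> \<sigma> = \<tau>) \<or> (q = w \<and> \<sigma> = \<rho>)"
    using q(1,3) pm by (auto simp: point_def split: if_splits)
  then show ?thesis using q2 by (auto simp: joint_def)
qed

text \<open>These vertices take the part of those missed by some maximum matching; outside a maximal
  \<open>X\<close> every critical vertex turns out to be of this kind.\<close>

definition bicritical :: "'v \<Rightarrow> bool" where
  "bicritical v \<longleftrightarrow> v \<noteq> r \<and> critical v 1 \<and> critical v (-1)"

lemma bicriticalD: "bicritical v \<Longrightarrow> \<tau> = 1 \<or> \<tau> = -1 \<Longrightarrow> critical v \<tau>"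
  by (auto simp: bicritical_def)

text \<open>Otherwise every signing with excess \<open>+2\<close> at \<open>v\<close> has sign
  \<open>-1\<close> on the arc, and every one with excess \<open>-2\<close> has sign
  \<open>+1\<close>. Reversing the arc in one of the former gives excess 4 at \<open>v\<close> and
  agreement with the latter on the arc. Repairing the head by a jump towards the latter then brings
  the excess back to 2 with the arc still positive, a contradiction.\<close>

lemma bicritical_arc_witness:
  assumes "bicritical v" "fst a \<in> E" "arc_tail ends a = v" "arc_head ends a \<noteq> v"
  shows "\<exists>\<tau> x. (\<tau> = 1 \<or> \<tau> = -1) \<and> signing x \<and>
    imb x = (\<lambda>u. point r (k + 2) u + point v (2 * \<tau>) u) \<and> tail_sign \<gamma> x a = \<tau>"
proof (rule ccontr)
  assume no: "\<not> ?thesis"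
  have vr: "v \<noteq> r" using assms(1) by (simp add: bicritical_def)
  obtain x1 where x1: "signing x1" "imb x1 = (\<lambda>u. point r (k + 2) u + point v 2 u)"
    using assms(1) by (auto simp: bicritical_def critical_def feasible_def)
  obtain x2 where x2: "signing x2" "imb x2 = (\<lambda>u. point r (k + 2) u + point v (-2) u)"
    using assms(1) by (auto simp: bicritical_def critical_def feasible_def)
  have no_witness: "tail_sign \<gamma> x a \<noteq> \<tau>"
    if "\<tau> = 1 \<or> \<tau> = -1" "signing x"
      "imb x = (\<lambda>u. point r (k + 2) u + point v (2 * \<tau>) u)" for \<tau> x
    using no that by blast
  have t1: "tail_sign \<gamma> x1 a = -1"
    using no_witness[of 1 x1] x1 tail_sign_cases[OF x1(1), of \<gamma> a] by simp
  have t2: "tail_sign \<gamma> x2 a = 1"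
    using no_witness[of "-1" x2] x2 tail_sign_cases[OF x2(1), of \<gamma> a] by simp
  define w where "w = arc_head ends a"
  define \<rho> where "\<rho> = - head_sign \<gamma> x1 a"
  have \<rho>: "\<rho> = 1 \<or> \<rho> = -1" using t1 by (auto simp: \<rho>_def head_sign_eq)
  have wv: "w \<noteq> v" using assms by (simp add: w_def)
  let ?y = "x1(fst a := - x1 (fst a))"
  have y: "signing ?y" using x1(1) by (rule signing_flip)
  have yt: "tail_sign \<gamma> ?y a = 1" using t1 by (simp add: tail_sign_flip)
  have iy: "imb ?y = (\<lambda>u. point r (k + 2) u + point v 4 u + point w (2 * \<rho>) u)"
    using imb_flip[OF assms(2), of x1] t1 assms(3) x1(2)
    by (auto simp: w_def \<rho>_def point_def)
  \<comment> \<open>The jump starts by undoing the change at \<open>w\<close>. After that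
    \<open>?y\<close> and \<open>x2\<close> differ in imbalance only at \<open>v\<close>, which
    determines the second step.\<close>
  have step: "- \<rho> * (imb x2 w - imb ?y w) > 0" "- \<rho> = 1 \<or> - \<rho> = -1"
    unfolding iy x2(2) using \<rho> wv by (auto simp: point_def)
  obtain z q \<sigma> where z: "signing z" "\<sigma> = 1 \<or> \<sigma> = -1"
    "imb z = (\<lambda>u. imb ?y u + point w (2 * - \<rho>) u + point q (2 * \<sigma>) u)"
    "\<sigma> * (imb x2 q - imb ?y q - point w (2 * - \<rho>) q) > 0"
    "\<forall>e. ?y e = x2 e \<longrightarrow> z e = ?y e"
    by (rule jumpE[OF y x2(1) step(2,1)])
  have "q = v \<and> \<sigma> = -1"
    using z(2,4) \<rho> wv vr unfolding iy x2(2) by (auto simp: point_def split: if_splits)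
  then have "imb z = (\<lambda>u. point r (k + 2) u + point v (2 * 1) u)"
    unfolding z(3) iy using vr wv by (auto simp: point_def)
  moreover have "tail_sign \<gamma> z a = 1"
    using z(5) yt t2 tail_sign_eq_iff by metis
  ultimately show False using no_witness[OF _ z(1), of 1] by simp
qed

text \<open>In the signing from \<open>bicritical_arc_witness\<close> the arc carries the sign of
  the excess at \<open>v\<close>, so reversing it moves the excess across to the head.\<close>

lemma bicritical_neighbour:
  assumes "bicritical v" "fst a \<in> E" "arc_tail ends a = v" "arc_head ends a \<noteq> v"
  shows "\<exists>\<rho>. (\<rho> = 1 \<or> \<rho> = -1) \<and> critical (arc_head ends a) \<rho>"
proof -
  obtain \<tau> x where x: "\<tau> = 1 \<or> \<tau> = -1" "signing x"
    "imb x = (\<lambda>u. point r (k + 2) u + point v (2 * \<tau>) u)" "tail_sign \<gamma> x a = \<tau>"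
    using bicritical_arc_witness[OF assms] by auto
  have "imb (x(fst a := - x (fst a))) =
    (\<lambda>u. point r (k + 2) u + point (arc_head ends a) (2 * - head_sign \<gamma> x a) u)"
    using imb_flip[OF assms(2), of x] x assms(3) by (auto simp: point_def)
  then have "critical (arc_head ends a) (- head_sign \<gamma> x a)"
    using signing_flip[OF x(2)] by (auto simp: critical_def feasible_def)
  then show ?thesis using x(1,4) by (auto simp: head_sign_eq split: if_splits)
qed

text \<open>Two signings with root imbalance \<open>k + 2\<close>, \<open>x\<close> and its reversal
  \<open>?x\<close> on the arc, put the payment at \<open>v\<close> and at \<open>w\<close>
  respectively. A joint signing \<open>y\<close> agrees with one of them on the arc. Raising the
  root by a jump towards \<open>y\<close> either cancels the payment at once, or leaves payments at
  \<open>v\<close> and \<open>w\<close> that reversing the untouched arc cancels; both give root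
  imbalance \<open>k + 4\<close>.\<close>

lemma not_joint_adjacent:
  assumes "bicritical v" "bicritical w" "v \<noteq> w"
    and a: "fst a \<in> E" "arc_tail ends a = v" "arc_head ends a = w"
    and pm: "\<alpha> = 1 \<or> \<alpha> = -1" "\<beta> = 1 \<or> \<beta> = -1"
  shows "\<not> joint v \<alpha> w \<beta>"
proof
  assume j0: "joint v \<alpha> w \<beta>"
  have r: "v \<noteq> r" "w \<noteq> r" using assms(1,2) by (auto simp: bicritical_def)
  \<comment> \<open>One joint pair of signs yields all four: an exchange with the opposite sign at
    \<open>v\<close> cannot retain the old payment at \<open>v\<close>, so it retains the one at
    \<open>w\<close>.\<close>
  have flip1: "joint v (- \<alpha>) w \<beta>" if "joint v \<alpha> w \<beta>" "\<alpha> = 1 \<or> \<alpha> = -1" "\<beta> = 1 \<or> \<beta> = -1" for \<alpha> \<beta>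
    using joint_exchange[OF that(1) bicriticalD[OF assms(1), of "- \<alpha>"]] that r
      not_joint_opposite[of v \<alpha>] by (auto simp: joint_commute)
  have flip2: "joint v \<alpha> w (- \<beta>)" if "joint v \<alpha> w \<beta>" "\<alpha> = 1 \<or> \<alpha> = -1" "\<beta> = 1 \<or> \<beta> = -1" for \<alpha> \<beta>
    using joint_exchange[OF that(1) bicriticalD[OF assms(2), of "- \<beta>"]] that r
      not_joint_opposite[of w \<beta>] by (auto simp: joint_commute)
  have all: "joint v \<alpha>' w \<beta>'" if "\<alpha>' = 1 \<or> \<alpha>' = -1" "\<beta>' = 1 \<or> \<beta>' = -1" for \<alpha>' \<beta>'
    using j0 flip1[OF j0 pm] flip2[OF j0 pm] flip2[OF flip1[OF j0 pm]] pm that by auto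
  define \<kappa> :: int where "\<kappa> = (if \<gamma> (fst a) then 1 else -1)"
  have \<kappa>: "\<kappa> = 1 \<or> \<kappa> = -1" by (simp add: \<kappa>_def)
  have hs: "head_sign \<gamma> x a = \<kappa> * tail_sign \<gamma> x a" for x
    by (simp add: head_sign_eq \<kappa>_def)
  obtain \<tau> x where x: "\<tau> = 1 \<or> \<tau> = -1" "signing x"
    "imb x = (\<lambda>u. point r (k + 2) u + point v (2 * \<tau>) u)" "tail_sign \<gamma> x a = \<tau>"
    using bicritical_arc_witness[OF assms(1) a(1,2)] a(3) assms(3) by auto
  have \<kappa>\<tau>: "\<kappa> * \<tau> = 1 \<or> \<kappa> * \<tau> = -1" using \<kappa> x(1) by auto
  let ?x = "x(fst a := - x (fst a))"
  have x': "signing ?x" "tail_sign \<gamma> ?x a = - \<tau>"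
    "imb ?x = (\<lambda>u. point r (k + 2) u + point w (2 * - (\<kappa> * \<tau>)) u)"
    using imb_flip[OF a(1), of x] x a(2,3) signing_flip[OF x(2)]
    by (auto simp: point_def tail_sign_flip hs)
  \<comment> \<open>The payments of \<open>y\<close> are opposite to that of \<open>x\<close> at
    \<open>v\<close> and to that of \<open>?x\<close> at \<open>w\<close>, so a step towards
    \<open>y\<close> at the paying vertex cancels its payment.\<close>
  obtain y where y: "signing y"
    "imb y = (\<lambda>u. point r (k + 4) u + point v (2 * - \<tau>) u + point w (2 * (\<kappa> * \<tau>)) u)"
    using all[of "- \<tau>" "\<kappa> * \<tau>"] \<kappa>\<tau> x(1) by (auto simp: joint_def feasible_def)
  have no: False if "signing z" "imb z = (\<lambda>u. point r (k + 4) u)" for z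
    using that not_feas_above[of "k + 4"] by (auto simp: feasible_def)
  show False
  proof (cases "tail_sign \<gamma> y a = \<tau>")
    case True
    have step: "1 * (imb y r - imb x r) > 0"
      unfolding y(2) x(3) using r by (auto simp: point_def)
    obtain z q \<sigma> where z: "signing z" "\<sigma> = 1 \<or> \<sigma> = -1"
      "imb z = (\<lambda>u. imb x u + point r (2 * 1) u + point q (2 * \<sigma>) u)"
      "\<sigma> * (imb y q - imb x q - point r (2 * 1) q) > 0"
      "\<forall>e. x e = y e \<longrightarrow> z e = x e"
      by (rule jumpE[OF x(2) y(1) disjI1[OF HOL.refl] step])
    have tz: "tail_sign \<gamma> z a = \<tau>"
      using z(5) x(4) True tail_sign_eq_iff by metis
    have "(q = v \<and> \<sigma> = - \<tau>) \<or> (q = w \<and> \<sigma> = \<kappa> * \<tau>)"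
      using z(2,4) x(1) \<kappa>\<tau> assms(3) r unfolding y(2) x(3)
      by (auto simp: point_def split: if_splits)
    then show False
    proof (elim disjE conjE)
      assume "q = v" "\<sigma> = - \<tau>"
      then show False
        using z(3) unfolding x(3) by (intro no[OF z(1)]) (auto simp: point_def)
    next
      assume "q = w" "\<sigma> = \<kappa> * \<tau>"
      then show False
        using z(3) tz a imb_flip[OF a(1), of z] assms(3) r unfolding x(3)
        by (intro no[OF signing_flip[OF z(1), of "fst a"]]) (auto simp: point_def hs)
    qed
  next
    case False
    then have ty: "tail_sign \<gamma> y a = - \<tau>"
      using tail_sign_cases[OF y(1), of \<gamma> a] x(1) by auto
    have step: "1 * (imb y r - imb ?x r) > 0"
      unfolding y(2) x'(3) using r by (auto simp: point_def)
    obtain z q \<sigma> where z: "signing z" "\<sigma> = 1 \<or> \<sigma> = -1"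
      "imb z = (\<lambda>u. imb ?x u + point r (2 * 1) u + point q (2 * \<sigma>) u)"
      "\<sigma> * (imb y q - imb ?x q - point r (2 * 1) q) > 0"
      "\<forall>e. ?x e = y e \<longrightarrow> z e = ?x e"
      by (rule jumpE[OF x'(1) y(1) disjI1[OF HOL.refl] step])
    have tz: "tail_sign \<gamma> z a = - \<tau>"
      using z(5) x'(2) ty tail_sign_eq_iff by metis
    have "(q = v \<and> \<sigma> = - \<tau>) \<or> (q = w \<and> \<sigma> = \<kappa> * \<tau>)"
      using z(2,4) x(1) \<kappa>\<tau> assms(3) r unfolding y(2) x'(3)
      by (auto simp: point_def split: if_splits)
    then show False
    proof (elim disjE conjE)
      assume "q = w" "\<sigma> = \<kappa> * \<tau>"
      then show False
        using z(3) unfolding x'(3) by (intro no[OF z(1)]) (auto simp: point_def)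
    next
      assume "q = v" "\<sigma> = - \<tau>"
      then show False
        using z(3) tz a imb_flip[OF a(1), of z] assms(3) r unfolding x'(3)
        by (intro no[OF signing_flip[OF z(1), of "fst a"]]) (auto simp: point_def hs)
    qed
  qed
qed

lemma not_joint_self:
  assumes "bicritical v" "\<alpha> = 1 \<or> \<alpha> = -1" "\<beta> = 1 \<or> \<beta> = -1"
  shows "\<not> joint v \<alpha> v \<beta>"
proof
  assume j: "joint v \<alpha> v \<beta>"
  show False
    using joint_exchange[OF j bicriticalD[OF assms(1), of "- \<alpha>"]] assms j
      not_joint_opposite[of v \<alpha>] not_joint_opposite[of v \<beta>]
    by (auto simp: bicritical_def)
qed

text \<open>If \<open>u\<close> and \<open>w\<close> could pay jointly, an exchange with the
  critical vertex \<open>v\<close> would make \<open>v\<close> joint with one of them.\<close>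

lemma not_joint_trans:
  assumes "bicritical u" "bicritical v" "bicritical w"
    and "\<And>\<alpha> \<beta>. \<alpha> = 1 \<or> \<alpha> = -1 \<Longrightarrow> \<beta> = 1 \<or> \<beta> = -1 \<Longrightarrow> \<not> joint u \<alpha> v \<beta>"
    and "\<And>\<alpha> \<beta>. \<alpha> = 1 \<or> \<alpha> = -1 \<Longrightarrow> \<beta> = 1 \<or> \<beta> = -1 \<Longrightarrow> \<not> joint v \<alpha> w \<beta>"
    and "\<alpha> = 1 \<or> \<alpha> = -1" "\<beta> = 1 \<or> \<beta> = -1"
  shows "\<not> joint u \<alpha> w \<beta>"
proof
  assume j: "joint u \<alpha> w \<beta>"
  show False
    using joint_exchange[OF j bicriticalD[OF assms(2), of 1]] assms
    by (auto simp: bicritical_def joint_commute)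
qed

text \<open>Merging a vertex critical for exactly one sign into the root does not raise the maximum.\<close>

lemma one_sided_critical_bound:
  assumes "\<epsilon> = 1 \<or> \<epsilon> = -1" "v \<noteq> r" "critical v (- \<epsilon>)" "\<not> critical v \<epsilon>"
    and "feas (\<lambda>u. point r (k + 2 * i) u + point v (2 * \<epsilon> * j) u)"
  shows "i + j \<le> 0"
  using assms(5)
proof (induction "nat (\<bar>i\<bar> + \<bar>j\<bar>)" arbitrary: i j rule: less_induct)
  case less
  \<comment> \<open>Excesses over the maximal vector in units of 2, with the sign at
    \<open>v\<close> normalised by \<open>\<epsilon>\<close>: \<open>F 1 (-1)\<close> holds,
    \<open>F 1 1\<close> fails, and the claim concerns the plane of \<open>r\<close> and
    \<open>v\<close> only.\<close>
  define F where "F i j \<longleftrightarrow> feas (\<lambda>u. point r (k + 2 * i) u + point v (2 * \<epsilon> * j) u)" for i j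
  have F: "F i j" using less.prems by (simp add: F_def)
  have IH: "i' + j' \<le> 0" if "F i' j'" "\<bar>i'\<bar> + \<bar>j'\<bar> < \<bar>i\<bar> + \<bar>j\<bar>" for i' j'
    using less.hyps[of i' j'] that by (simp add: F_def)
  have F0: "F 0 0" using feas_root by (simp add: F_def point_def)
  have no20: "i \<le> 0" if "F i 0" for i
    using root_max[of "k + 2 * i"] that by (simp add: F_def point_def)
  have no11: "\<not> F 1 1" using assms(4) by (simp add: F_def critical_def)
  have yes: "F 1 (-1)" using assms(3) by (simp add: F_def critical_def)
  \<comment> \<open>\<open>jr\<close> and \<open>jv\<close> are the jump axiom in this plane with
    first step at \<open>r\<close> and at \<open>v\<close>. Both vectors agree outside the plane, so
    the second step stays inside.\<close>
  have jr: "(\<exists>\<rho>. (\<rho> = 1 \<or> \<rho> = -1) \<and> \<rho> * (i' - i - d) > 0 \<and> F (i + d + \<rho>) j) \<or>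
      (\<exists>\<rho>. (\<rho> = 1 \<or> \<rho> = -1) \<and> \<rho> * (j' - j) > 0 \<and> F (i + d) (j + \<rho>))"
    if "F i j" "F i' j'" "d = 1 \<or> d = -1" "d * (i' - i) > 0" for i j i' j' d
  proof -
    note prems = that
    obtain w \<rho> where w: "\<rho> = 1 \<or> \<rho> = -1"
      "feas (\<lambda>u. point r (k + 2 * i) u + point v (2 * \<epsilon> * j) u + point r (2 * d) u + point w (2 * \<rho>) u)"
      "\<rho> * (point r (k + 2 * i') w + point v (2 * \<epsilon> * j') w
         - (point r (k + 2 * i) w + point v (2 * \<epsilon> * j) w) - point r (2 * d) w) > 0"
      using prems(3,4) assms(2)
      by (rule_tac feas_jump[OF prems(1,2)[unfolded F_def] prems(3), of r]) (auto simp: point_def)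
    consider "w = r" | "w = v" using w(3) by (auto simp: point_def split: if_splits)
    then show ?thesis
    proof cases
      case 1
      have "F (i + d + \<rho>) j"
        using w(2) unfolding F_def by (rule back_subst[of feas]) (auto simp: 1 point_def)
      moreover have "\<rho> * (i' - i - d) > 0"
        using w(1,3) assms(2) by (auto simp: 1 point_def)
      ultimately show ?thesis using w(1) by blast
    next
      case 2
      have "F (i + d) (j + \<epsilon> * \<rho>)"
        using w(2) assms(1) unfolding F_def
        by (elim back_subst[of feas]) (auto simp: 2 point_def algebra_simps)
      moreover have "\<epsilon> * \<rho> * (j' - j) > 0"
        using w(1,3) assms(1,2) by (auto simp: 2 point_def)
      ultimately show ?thesis using w(1) assms(1) by (intro disjI2 exI[of _ "\<epsilon> * \<rho>"]) auto
    qed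
  qed
  have jv: "(\<exists>\<rho>. (\<rho> = 1 \<or> \<rho> = -1) \<and> \<rho> * (j' - j - d) > 0 \<and> F i (j + d + \<rho>)) \<or>
      (\<exists>\<rho>. (\<rho> = 1 \<or> \<rho> = -1) \<and> \<rho> * (i' - i) > 0 \<and> F (i + \<rho>) (j + d))"
    if "F i j" "F i' j'" "d = 1 \<or> d = -1" "d * (j' - j) > 0" for i j i' j' d
  proof -
    note prems = that
    have ed: "\<epsilon> * d = 1 \<or> \<epsilon> * d = -1" using assms(1) that(3) by auto
    obtain w \<rho> where w: "\<rho> = 1 \<or> \<rho> = -1"
      "feas (\<lambda>u. point r (k + 2 * i) u + point v (2 * \<epsilon> * j) u + point v (2 * (\<epsilon> * d)) u + point w (2 * \<rho>) u)"
      "\<rho> * (point r (k + 2 * i') w + point v (2 * \<epsilon> * j') w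
         - (point r (k + 2 * i) w + point v (2 * \<epsilon> * j) w) - point v (2 * (\<epsilon> * d)) w) > 0"
      using prems(3,4) assms(1,2)
      by (rule_tac feas_jump[OF prems(1,2)[unfolded F_def] ed, of v]) (auto simp: point_def)
    consider "w = r" | "w = v" using w(3) by (auto simp: point_def split: if_splits)
    then show ?thesis
    proof cases
      case 1
      have "F (i + \<rho>) (j + d)"
        using w(2) unfolding F_def by (rule back_subst[of feas]) (auto simp: 1 point_def algebra_simps)
      moreover have "\<rho> * (i' - i) > 0"
        using w(1,3) assms(2) by (auto simp: 1 point_def)
      ultimately show ?thesis using w(1) by blast
    next
      case 2
      have "F i (j + d + \<epsilon> * \<rho>)"
        using w(2) assms(1) unfolding F_def
        by (elim back_subst[of feas]) (auto simp: 2 point_def algebra_simps)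
      moreover have "\<epsilon> * \<rho> * (j' - j - d) > 0"
        using w(1,3) assms(1,2) by (auto simp: 2 point_def)
      ultimately show ?thesis using w(1) assms(1) by (intro disjI1 exI[of _ "\<epsilon> * \<rho>"]) auto
    qed
  qed
  show ?case
  proof (rule ccontr)
    assume "\<not> i + j \<le> 0"
    then have pos: "i + j \<ge> 1" by simp
    \<comment> \<open>Points far from the origin jump towards it to a smaller point that still
      violates the bound. Of the rest, \<open>(1, 0)\<close> and \<open>(2, 0)\<close> contradict
      maximality, \<open>(0, 1)\<close> has no second step towards the origin, \<open>(1, 1)\<close>
      is excluded, and \<open>(0, 2)\<close> jumps towards \<open>(1, -1)\<close> into
      \<open>(1, 1)\<close>.\<close>
    consider "j < 0" | "i < 0" | "i = 1" "j = 0" | "i = 0" "j = 1" | "i = 2" "j = 0" | "i = 1" "j = 1"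
      | "i = 0" "j = 2" | "i \<ge> 1" "j \<ge> 0" "i + j \<ge> 3" | "i = 0" "j \<ge> 3"
      using pos by linarith
    then show False
    proof cases
      case 1
      then show False using jv[OF F F0, of 1] IH pos by fastforce
    next
      case 2
      then show False using jr[OF F F0, of 1] IH pos by fastforce
    next
      case 3
      then show False using no20[of 1] F by simp
    next
      case 4
      then show False using jv[OF F F0, of "-1"] by auto
    next
      case 5
      then show False using no20[of 2] F by simp
    next
      case 6
      then show False using no11 F by simp
    next
      case 7
      then show False using jr[OF F yes, of 1] no11 by auto
    next
      case 8
      then show False using jr[OF F F0, of "-1"] IH pos by fastforce
    next
      case 9
      then show False using jv[OF F F0, of "-1"] IH pos by fastforce
    qed
  qed
qed

end

section \<open>Circuit decompositions and signings\<close>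

lemma trail_iff:
  "trail E ends t \<longleftrightarrow> t \<noteq> [] \<and> fst ` set t \<subseteq> E \<and> distinct (map fst t) \<and>
     successively (\<lambda>a a'. arc_head ends a = arc_tail ends a') t"
  by (simp add: trail_def successively_conv_nth)

lemma circuit_mono: "circuit F ends t \<Longrightarrow> F \<subseteq> E \<Longrightarrow> circuit E ends t"
  by (auto simp: circuit_def trail_def)

lemma circuit_append:
  assumes "circuit E ends s" "circuit E ends t" "arc_tail ends (hd s) = arc_tail ends (hd t)"
    "fst ` set s \<inter> fst ` set t = {}"
  shows "circuit E ends (s @ t)"
  using assms by (auto simp: circuit_def trail_iff successively_append_iff)

lemma circuit_rotate:
  assumes "circuit E ends (xs @ ys)" "ys \<noteq> []"
  shows "circuit E ends (ys @ xs)"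
  using assms by (cases "xs = []") (auto simp: circuit_def trail_iff successively_append_iff)

lemma circuit_hits_tail:
  assumes "circuit E ends t" "hits ends t v"
  shows "\<exists>a\<in>set t. arc_tail ends a = v"
proof -
  obtain a where a: "a \<in> set t" "arc_tail ends a = v \<or> arc_head ends a = v"
    using assms(2) by (auto simp: hits_def)
  have "\<exists>a\<in>set t. arc_tail ends a = v" if h: "arc_head ends a = v"
  proof -
    obtain xs ys where t: "t = xs @ a # ys" using a(1) by (auto dest: split_list)
    show ?thesis
    proof (cases ys)
      case Nil
      then have "arc_tail ends (hd t) = v" "hd t \<in> set t"
        using assms(1) h t hd_in_set[of t] by (simp_all add: circuit_def del: hd_in_set)
      then show ?thesis by blast
    next
      case (Cons a' zs)
      then show ?thesis using assms(1) h t
        by (auto simp: circuit_def trail_iff successively_append_iff)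
    qed
  qed
  then show ?thesis using a by blast
qed

lemma circuit_from:
  assumes "circuit E ends t" "hits ends t v"
  shows "\<exists>t'. circuit E ends t' \<and> set t' = set t \<and> arc_tail ends (hd t') = v"
proof -
  obtain a where a: "a \<in> set t" "arc_tail ends a = v"
    using circuit_hits_tail[OF assms] by blast
  obtain xs ys where t: "t = xs @ a # ys" using a(1) by (auto dest: split_list)
  have "circuit E ends ((a # ys) @ xs)"
    using assms(1) unfolding t by (rule circuit_rotate) simp
  then show ?thesis using a(2) t by (intro exI[of _ "(a # ys) @ xs"]) auto
qed

section \<open>Imbalance and weight of alternating trails\<close>

definition alternating :: "('e \<Rightarrow> bool) \<Rightarrow> ('e \<Rightarrow> int) \<Rightarrow> ('e \<times> bool) list \<Rightarrow> bool" where
  "alternating \<gamma> x t \<longleftrightarrow> successively (\<lambda>a a'. head_sign \<gamma> x a = - tail_sign \<gamma> x a') t"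

lemma imbalance_insert:
  assumes "finite F" "fst a \<notin> F"
  shows "imbalance (insert (fst a) F) ends \<gamma> x v =
    point (arc_tail ends a) (tail_sign \<gamma> x a) v + point (arc_head ends a) (head_sign \<gamma> x a) v
      + imbalance F ends \<gamma> x v"
  unfolding end_signs_arc[symmetric] imbalance_def using assms by (simp add: add.assoc)

lemma imbalance_union:
  assumes "finite F" "finite G" "F \<inter> G = {}"
  shows "imbalance (F \<union> G) ends \<gamma> x v = imbalance F ends \<gamma> x v + imbalance G ends \<gamma> x v"
  unfolding imbalance_def by (rule sum.union_disjoint[OF assms])

lemma imbalance_diff:
  assumes "finite F" "G \<subseteq> F"
  shows "imbalance (F - G) ends \<gamma> x v = imbalance F ends \<gamma> x v - imbalance G ends \<gamma> x v"
  unfolding imbalance_def by (rule sum_diff[OF assms])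

lemma imbalance_cong:
  assumes "\<And>e. e \<in> F \<Longrightarrow> x e = y e"
  shows "imbalance F ends \<gamma> x v = imbalance F ends \<gamma> y v"
  unfolding imbalance_def using assms by (intro sum.cong) auto

text \<open>The two half-edges used at each passage cancel, so only the first and the last half-edge
  remain.\<close>

lemma imbalance_alternating_trail:
  assumes "t \<noteq> []" "distinct (map fst t)"
    "successively (\<lambda>a a'. arc_head ends a = arc_tail ends a') t" "alternating \<gamma> x t"
  shows "imbalance (fst ` set t) ends \<gamma> x v =
    point (arc_tail ends (hd t)) (tail_sign \<gamma> x (hd t)) v
      + point (arc_head ends (last t)) (head_sign \<gamma> x (last t)) v"
  using assms
proof (induction t rule: list_nonempty_induct)
  case (single a)
  then show ?case using imbalance_insert[of "{}" a ends \<gamma> x v] by (simp add: imbalance_def)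
next
  case (cons a t)
  then obtain a' t' where t: "t = a' # t'" by (cases t) auto
  have "imbalance (fst ` set (a # t)) ends \<gamma> x v =
    point (arc_tail ends a) (tail_sign \<gamma> x a) v + point (arc_head ends a) (head_sign \<gamma> x a) v
      + imbalance (fst ` set t) ends \<gamma> x v"
    using cons.prems by (simp add: imbalance_insert)
  then show ?case
    using cons.IH cons.prems unfolding t by (auto simp: alternating_def point_def)
qed

lemma nonzero_trail_append:
  assumes "fst ` set s \<inter> fst ` set t = {}"
  shows "nonzero_trail \<gamma> (s @ t) \<longleftrightarrow> nonzero_trail \<gamma> s \<noteq> nonzero_trail \<gamma> t"
proof -
  have eq: "{e \<in> set (map fst (s @ t)). \<gamma> e} = {e \<in> set (map fst s). \<gamma> e} \<union> {e \<in> set (map fst t). \<gamma> e}"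
    by auto
  have "card {e \<in> set (map fst (s @ t)). \<gamma> e} =
      card {e \<in> set (map fst s). \<gamma> e} + card {e \<in> set (map fst t). \<gamma> e}"
    unfolding eq by (rule card_Un_disjoint) (use assms in auto)
  then show ?thesis by (simp add: nonzero_trail_def)
qed

lemma nonzero_trail_cong: "set s = set t \<Longrightarrow> nonzero_trail \<gamma> s \<longleftrightarrow> nonzero_trail \<gamma> t"
  by (simp add: nonzero_trail_def)

lemma nonzero_trail_single: "nonzero_trail \<gamma> [a] \<longleftrightarrow> \<gamma> (fst a)"
proof -
  have "{e. e = fst a \<and> \<gamma> e} = (if \<gamma> (fst a) then {fst a} else {})" by auto
  then show ?thesis by (simp add: nonzero_trail_def)
qed

lemma head_sign_eq_tail_sign:
  "signing x \<Longrightarrow> head_sign \<gamma> x a = tail_sign \<gamma> x a \<longleftrightarrow> \<gamma> (fst a)"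
  using tail_sign_cases[of x \<gamma> a] by (auto simp: head_sign_eq)

lemma head_sign_cases: "signing x \<Longrightarrow> head_sign \<gamma> x a = 1 \<or> head_sign \<gamma> x a = -1"
  using tail_sign_cases[of x \<gamma> a] by (auto simp: head_sign_eq)

text \<open>The sign changes on every zero edge and at each of the \<open>length t - 1\<close>
  passages. The number of changes has the parity of the number of non-zero edges plus one.\<close>

lemma nonzero_alternating_trail:
  assumes "signing x" "t \<noteq> []" "distinct (map fst t)" "alternating \<gamma> x t"
  shows "nonzero_trail \<gamma> t \<longleftrightarrow> head_sign \<gamma> x (last t) = tail_sign \<gamma> x (hd t)"
  using assms(2-)
proof (induction t rule: list_nonempty_induct)
  case (single a)
  then show ?case
    by (simp add: nonzero_trail_single head_sign_eq_tail_sign[OF assms(1)])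
next
  case (cons a t)
  have IH: "nonzero_trail \<gamma> t \<longleftrightarrow> head_sign \<gamma> x (last t) = tail_sign \<gamma> x (hd t)"
    using cons by (simp add: alternating_def successively_Cons)
  have nz: "nonzero_trail \<gamma> (a # t) \<longleftrightarrow> \<gamma> (fst a) \<noteq> nonzero_trail \<gamma> t"
    using nonzero_trail_append[of "[a]" t \<gamma>] cons.prems by (simp add: nonzero_trail_single)
  have h: "head_sign \<gamma> x a = - tail_sign \<gamma> x (hd t)"
    using cons.prems cons.hyps by (simp add: alternating_def successively_Cons)
  have combine: "(g \<noteq> (L = T)) \<longleftrightarrow> L = A"
    if "A = 1 \<or> A = -1" "L = 1 \<or> L = -1" "H = - T" "H = 1 \<or> H = -1" "H = A \<longleftrightarrow> g"
    for A L T H :: int and g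
    using that by auto
  show ?case
    unfolding nz IH last_ConsR[OF cons.hyps(1)] list.sel
    by (rule combine[OF tail_sign_cases head_sign_cases h head_sign_cases head_sign_eq_tail_sign])
      (rule assms(1))+
qed

lemma ex_alternating:
  assumes "t \<noteq> []" "distinct (map fst t)" "\<alpha> = 1 \<or> \<alpha> = (-1::int)"
  shows "\<exists>x. signing x \<and> alternating \<gamma> x t \<and> tail_sign \<gamma> x (hd t) = \<alpha>"
  using assms
proof (induction t arbitrary: \<alpha> rule: list_nonempty_induct)
  case (single a)
  then show ?case
    by (intro exI[of _ "\<lambda>_. if snd a \<or> \<gamma> (fst a) then \<alpha> else - \<alpha>"])
      (auto simp: signing_def alternating_def tail_sign_def)
next
  case (cons a t)
  define c where "c = (if snd a \<or> \<gamma> (fst a) then \<alpha> else - \<alpha>)"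
  \<comment> \<open>The sign forced on the tail of the next arc: the negative of the sign that
    \<open>\<alpha>\<close> induces at the head of \<open>a\<close>.\<close>
  define \<beta> where "\<beta> = (if \<gamma> (fst a) then - \<alpha> else \<alpha>)"
  have "\<beta> = 1 \<or> \<beta> = -1" "distinct (map fst t)"
    using cons.prems by (auto simp: \<beta>_def)
  then obtain x where x: "signing x" "alternating \<gamma> x t" "tail_sign \<gamma> x (hd t) = \<beta>"
    using cons.IH by blast
  let ?y = "x(fst a := c)"
  have off: "tail_sign \<gamma> ?y a' = tail_sign \<gamma> x a'" "head_sign \<gamma> ?y a' = head_sign \<gamma> x a'"
    if "a' \<in> set t" for a'
  proof -
    have "fst a \<notin> fst ` set t" using cons.prems(1) by simp
    then have "fst a' \<noteq> fst a" using that by (metis imageI)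
    then show "tail_sign \<gamma> ?y a' = tail_sign \<gamma> x a'" "head_sign \<gamma> ?y a' = head_sign \<gamma> x a'"
      by (simp_all add: tail_sign_def head_sign_def)
  qed
  have y1: "alternating \<gamma> ?y t"
    using x(2) unfolding alternating_def
    by (rule successively_cong[THEN iffD1, rotated -1]) (auto simp: off)
  have y2: "head_sign \<gamma> ?y a = - tail_sign \<gamma> ?y (hd t)" "tail_sign \<gamma> ?y a = \<alpha>"
    using x(3) off(1)[of "hd t"] cons.hyps
    by (auto simp: head_sign_def tail_sign_def c_def \<beta>_def)
  have "signing ?y"
    using x(1) cons.prems by (auto simp: signing_def c_def)
  moreover have "alternating \<gamma> ?y (a # t)"
    using y1 y2(1) cons.hyps unfolding alternating_def successively_Cons by blast
  moreover have "tail_sign \<gamma> ?y (hd (a # t)) = \<alpha>"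
    using y2(2) by (simp only: list.sel)
  ultimately show ?case by blast
qed

text \<open>\<open>alternating\<close> exempts the return from the last arc to the first, so the
  base vertex takes the whole imbalance: 0 for a zero circuit, 2 or -2 for a non-zero one.\<close>

lemma imbalance_alternating_circuit:
  assumes "circuit E ends t" "alternating \<gamma> x t"
  shows "imbalance (fst ` set t) ends \<gamma> x v =
    point (arc_tail ends (hd t)) (tail_sign \<gamma> x (hd t) + head_sign \<gamma> x (last t)) v"
  using assms imbalance_alternating_trail[of t ends \<gamma> x v]
  by (auto simp: circuit_def trail_iff point_def)

text \<open>From circuits to signings: each circuit, started at \<open>b\<close> with sign 1 and
  alternated, contributes 2 at \<open>b\<close> and nothing elsewhere. Disjointness of the edge sets
  allows the signs to be glued.\<close>

lemma signing_of_circuits: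
  assumes "distinct (concat (map (map fst) C))"
    "\<forall>c\<in>set C. circuit E ends c \<and> nonzero_trail \<gamma> c \<and> hits ends c b"
  shows "\<exists>x. signing x \<and>
    (\<forall>v. imbalance (set (concat (map (map fst) C))) ends \<gamma> x v = point b (2 * int (length C)) v)"
  using assms
proof (induction C)
  case Nil
  then show ?case by (intro exI[of _ "\<lambda>_. 1"]) (auto simp: signing_def imbalance_def point_def)
next
  case (Cons c C)
  let ?F = "set (concat (map (map fst) C))"
  obtain x where x: "signing x" "\<And>v. imbalance ?F ends \<gamma> x v = point b (2 * int (length C)) v"
    using Cons by auto
  obtain t where t: "circuit E ends t" "set t = set c" "arc_tail ends (hd t) = b"
    using circuit_from[of E ends c b] Cons.prems by auto
  have tt: "t \<noteq> []" "distinct (map fst t)" using t(1) by (auto simp: circuit_def trail_iff)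
  obtain y where y: "signing y" "alternating \<gamma> y t" "tail_sign \<gamma> y (hd t) = 1"
    using ex_alternating[OF tt, of 1 \<gamma>] by auto
  have "head_sign \<gamma> y (last t) = 1"
    using nonzero_alternating_trail[OF y(1) tt y(2)] Cons.prems(2) t(2) y(3)
      nonzero_trail_cong[OF t(2), of \<gamma>] by auto
  then have ib: "imbalance (fst ` set c) ends \<gamma> y v = point b 2 v" for v
    using imbalance_alternating_circuit[OF t(1) y(2), of v] t y(3) by simp
  define z where "z = (\<lambda>e. if e \<in> fst ` set c then y e else x e)"
  have dj: "fst ` set c \<inter> ?F = {}" using Cons.prems(1) by auto
  have "imbalance (fst ` set c \<union> ?F) ends \<gamma> z v = point b (2 * int (length (c # C))) v" for v
  proof -
    have "imbalance (fst ` set c \<union> ?F) ends \<gamma> z v =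
        imbalance (fst ` set c) ends \<gamma> z v + imbalance ?F ends \<gamma> z v"
      by (rule imbalance_union) (use dj in auto)
    also have "imbalance (fst ` set c) ends \<gamma> z v = imbalance (fst ` set c) ends \<gamma> y v"
      by (rule imbalance_cong) (auto simp: z_def)
    also have "imbalance ?F ends \<gamma> z v = imbalance ?F ends \<gamma> x v"
      by (rule imbalance_cong) (use dj in \<open>auto simp: z_def\<close>)
    finally show ?thesis by (simp only: ib x(2)) (simp add: point_def)
  qed
  moreover have "signing z" using x(1) y(1) by (auto simp: signing_def z_def)
  ultimately show ?case by (intro exI[of _ z]) auto
qed

section \<open>Extracting circuits from a signing\<close>

lemma maximal_trail:
  assumes "finite F" "fst a0 \<in> F"
  shows "\<exists>t. trail F ends t \<and> hd t = a0 \<and> successively S t \<and>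
    (\<forall>a. fst a \<in> F - fst ` set t \<and> arc_tail ends a = arc_head ends (last t) \<longrightarrow> \<not> S (last t) a)"
proof -
  define T where "T t \<longleftrightarrow> trail F ends t \<and> hd t = a0 \<and> successively S t" for t
  have T0: "T [a0]" using assms by (auto simp: T_def trail_iff)
  have bound: "length t < Suc (card F)" if "T t" for t
  proof -
    have "length t = card (set (map fst t))"
      using that distinct_card[of "map fst t"] by (auto simp: T_def trail_iff)
    also have "\<dots> \<le> card F"
      using that assms(1) by (intro card_mono) (auto simp: T_def trail_iff)
    finally show ?thesis by simp
  qed
  obtain t where t: "T t" "\<And>s. T s \<Longrightarrow> length s \<le> length t"
    using ex_has_greatest_nat[of T "[a0]" length "Suc (card F)"] T0 bound by (metis less_imp_le)
  have "\<not> S (last t) a" if "fst a \<in> F - fst ` set t" "arc_tail ends a = arc_head ends (last t)" for a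
  proof
    assume "S (last t) a"
    then have "T (t @ [a])"
      using t(1) that by (auto simp: T_def trail_iff successively_append_iff)
    then show False using t(2) by fastforce
  qed
  then show ?thesis using t(1) unfolding T_def by blast
qed

lemma imbalance_pos_arc:
  assumes "imbalance F ends \<gamma> x v > 0" "signing x"
  shows "\<exists>a. fst a \<in> F \<and> arc_tail ends a = v \<and> tail_sign \<gamma> x a = 1"
proof -
  obtain e where e: "e \<in> F"
    "point (fst (ends e)) (x e) v + point (snd (ends e)) (if \<gamma> e then x e else - x e) v > 0"
    using assms(1) unfolding imbalance_def by (meson not_less sum_nonpos)
  have pm: "x e = 1 \<or> x e = -1" using assms(2) by (auto simp: signing_def)
  show ?thesis
  proof (cases "fst (ends e) = v \<and> x e = 1")
    case True
    then show ?thesis using e(1)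
      by (intro exI[of _ "(e, True)"]) (simp add: arc_tail_def tail_sign_def)
  next
    case False
    then have "snd (ends e) = v" "(if \<gamma> e then x e else - x e) = 1"
      using e(2) pm by (auto simp: point_def split: if_splits)
    then show ?thesis using e(1)
      by (intro exI[of _ "(e, False)"]) (auto simp: arc_tail_def tail_sign_def split: if_splits)
  qed
qed

lemma imbalance_same_sign:
  assumes "\<And>a. fst a \<in> F \<Longrightarrow> arc_tail ends a = v \<Longrightarrow> tail_sign \<gamma> x a = \<beta>"
  shows "\<beta> * imbalance F ends \<gamma> x v \<ge> 0"
  unfolding imbalance_def sum_distrib_left
proof (rule sum_nonneg)
  fix e assume e: "e \<in> F"
  have "fst (ends e) = v \<Longrightarrow> x e = \<beta>"
    using assms[of "(e, True)"] e by (simp add: arc_tail_def tail_sign_def)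
  moreover have "snd (ends e) = v \<Longrightarrow> (if \<gamma> e then x e else - x e) = \<beta>"
    using assms[of "(e, False)"] e by (auto simp: arc_tail_def tail_sign_def split: if_splits)
  ultimately show "0 \<le> \<beta> * (point (fst (ends e)) (x e) v
      + point (snd (ends e)) (if \<gamma> e then x e else - x e) v)"
    by (simp add: point_def distrib_left)
qed

text \<open>When an alternating trail cannot be continued, all half-edges left over at its end share
  the sign of its last half-edge. The inequality expresses this through the imbalance of
  \<open>F\<close>; it is strong enough to locate the end and determine its sign in both extractions
  below.\<close>

lemma maximal_alternating_trail:
  assumes "finite F" "signing x" "fst a0 \<in> F"
  obtains t where "trail F ends t" "alternating \<gamma> x t" "hd t = a0"
    "head_sign \<gamma> x (last t) * (imbalance F ends \<gamma> x (arc_head ends (last t))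
      - point (arc_tail ends a0) (tail_sign \<gamma> x a0) (arc_head ends (last t))
      - head_sign \<gamma> x (last t)) \<ge> 0"
proof -
  obtain t where t: "trail F ends t" "hd t = a0" "alternating \<gamma> x t"
    and mx: "\<And>a. fst a \<in> F - fst ` set t \<Longrightarrow> arc_tail ends a = arc_head ends (last t) \<Longrightarrow>
      head_sign \<gamma> x (last t) \<noteq> - tail_sign \<gamma> x a"
    using maximal_trail[OF assms(1,3), of ends "\<lambda>a a'. head_sign \<gamma> x a = - tail_sign \<gamma> x a'"]
    by (auto simp: alternating_def)
  let ?v = "arc_head ends (last t)" and ?\<beta> = "head_sign \<gamma> x (last t)"
  have "?\<beta> * imbalance (F - fst ` set t) ends \<gamma> x ?v \<ge> 0"
  proof (rule imbalance_same_sign)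
    fix a assume "fst a \<in> F - fst ` set t" "arc_tail ends a = ?v"
    then show "tail_sign \<gamma> x a = ?\<beta>"
      using mx[of a] tail_sign_cases[OF assms(2), of \<gamma> a] head_sign_cases[OF assms(2), of \<gamma> "last t"]
      by auto
  qed
  moreover have "fst ` set t \<subseteq> F" using t(1) by (auto simp: trail_iff)
  moreover have "imbalance (fst ` set t) ends \<gamma> x ?v =
      point (arc_tail ends a0) (tail_sign \<gamma> x a0) ?v + ?\<beta>"
    using imbalance_alternating_trail[of t ends \<gamma> x ?v] t by (auto simp: trail_iff point_def)
  ultimately show ?thesis
    using t assms(1) by (intro that[of t]) (simp_all add: imbalance_diff algebra_simps)
qed

text \<open>With all imbalances 0, the inequality for a maximal alternating trail holds only if the
  trail returns to its start with the sign opposite to the first one.\<close>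

lemma extract_zero_circuit:
  assumes "finite F" "signing x" "\<And>v. imbalance F ends \<gamma> x v = 0" "fst a0 \<in> F"
  shows "\<exists>z. circuit F ends z \<and> arc_tail ends (hd z) = arc_tail ends a0 \<and> \<not> nonzero_trail \<gamma> z \<and>
    (\<forall>v. imbalance (F - fst ` set z) ends \<gamma> x v = 0)"
proof -
  obtain t where t: "trail F ends t" "alternating \<gamma> x t" "hd t = a0"
    and b: "head_sign \<gamma> x (last t) * (- point (arc_tail ends a0) (tail_sign \<gamma> x a0) (arc_head ends (last t))
        - head_sign \<gamma> x (last t)) \<ge> 0"
    using maximal_alternating_trail[OF assms(1,2,4), of ends \<gamma>] unfolding assms(3) diff_0 .
  have hs: "head_sign \<gamma> x (last t) = 1 \<or> head_sign \<gamma> x (last t) = -1"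
    by (rule head_sign_cases[OF assms(2)])
  have ts: "tail_sign \<gamma> x a0 = 1 \<or> tail_sign \<gamma> x a0 = -1"
    using tail_sign_cases[OF assms(2)] .
  have cl: "arc_head ends (last t) = arc_tail ends a0" "head_sign \<gamma> x (last t) = - tail_sign \<gamma> x a0"
    using b hs ts by (auto simp: point_def split: if_splits)
  have c: "circuit F ends t" using t cl(1) by (simp add: circuit_def)
  have "\<not> nonzero_trail \<gamma> t"
    using nonzero_alternating_trail[OF assms(2) _ _ t(2)] t(1,3) cl(2) ts by (auto simp: trail_iff)
  moreover have "imbalance (F - fst ` set t) ends \<gamma> x v = 0" for v
    using imbalance_diff[OF assms(1), of "fst ` set t" ends \<gamma> x v] t(1,3) assms(3) cl(2)
      imbalance_alternating_circuit[OF c t(2), of v] by (auto simp: trail_iff point_def)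
  ultimately show ?thesis using c t(3) by auto
qed

text \<open>From signings to circuits: a maximal alternating trail leaving \<open>b\<close> with
  sign 1 can only end at \<open>b\<close>, again with sign 1, so it is a non-zero circuit and
  removing it lowers the imbalance at \<open>b\<close> by 2.\<close>

lemma extract_nonzero_circuits:
  assumes "finite F" "signing x" "\<And>v. imbalance F ends \<gamma> x v = point b (2 * int k) v"
  shows "\<exists>C. length C = k \<and> distinct (concat (map (map fst) C)) \<and>
    (\<forall>c\<in>set C. circuit F ends c \<and> nonzero_trail \<gamma> c \<and> hits ends c b) \<and>
    (\<forall>v. imbalance (F - set (concat (map (map fst) C))) ends \<gamma> x v = 0)"
  using assms
proof (induction k arbitrary: F)
  case 0
  then show ?case by (auto simp: point_def)
next
  case (Suc k)
  obtain a0 where a0: "fst a0 \<in> F" "arc_tail ends a0 = b" "tail_sign \<gamma> x a0 = 1"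
    using imbalance_pos_arc[OF _ Suc.prems(2), of F ends \<gamma> b] Suc.prems(3) by (auto simp: point_def)
  obtain t where t: "trail F ends t" "alternating \<gamma> x t" "hd t = a0"
    and b: "head_sign \<gamma> x (last t) * (point b (2 * int (Suc k)) (arc_head ends (last t))
        - point b 1 (arc_head ends (last t)) - head_sign \<gamma> x (last t)) \<ge> 0"
    using maximal_alternating_trail[OF Suc.prems(1,2) a0(1), of ends \<gamma>]
    unfolding Suc.prems(3) a0(2,3) .
  have hs: "head_sign \<gamma> x (last t) = 1 \<or> head_sign \<gamma> x (last t) = -1"
    by (rule head_sign_cases[OF Suc.prems(2)])
  have cl: "arc_head ends (last t) = b" "head_sign \<gamma> x (last t) = 1"
    using b hs by (auto simp: point_def split: if_splits)
  have c: "circuit F ends t" using t a0 cl(1) by (simp add: circuit_def)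
  have nz: "nonzero_trail \<gamma> t"
    using nonzero_alternating_trail[OF Suc.prems(2) _ _ t(2)] t(1,3) cl(2) a0 by (auto simp: trail_iff)
  have ht: "hits ends t b"
    using t(1,3) a0(2) by (auto simp: hits_def trail_iff intro!: bexI[of _ "hd t"])
  let ?G = "F - fst ` set t"
  have G: "imbalance ?G ends \<gamma> x v = point b (2 * int k) v" for v
    using imbalance_diff[OF Suc.prems(1), of "fst ` set t" ends \<gamma> x v] t(1,3) Suc.prems(3) cl(2) a0
      imbalance_alternating_circuit[OF c t(2), of v] by (auto simp: trail_iff point_def)
  obtain C where C: "length C = k" "distinct (concat (map (map fst) C))"
    "\<forall>c\<in>set C. circuit ?G ends c \<and> nonzero_trail \<gamma> c \<and> hits ends c b"
    "\<forall>v. imbalance (?G - set (concat (map (map fst) C))) ends \<gamma> x v = 0"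
    using Suc.IH[OF finite_Diff[OF Suc.prems(1)] Suc.prems(2) G] by blast
  have dj: "fst ` set t \<inter> set (concat (map (map fst) C)) = {}"
  proof -
    have "fst ` set c \<subseteq> ?G" if "c \<in> set C" for c
      using C(3) that by (simp add: circuit_def trail_iff)
    then show ?thesis by auto
  qed
  have eq: "F - set (concat (map (map fst) (t # C))) = ?G - set (concat (map (map fst) C))"
    by auto
  show ?case
  proof (intro exI[of _ "t # C"] conjI)
    show "distinct (concat (map (map fst) (t # C)))"
      using C(2) dj t(1) by (auto simp: trail_iff)
    show "\<forall>c\<in>set (t # C). circuit F ends c \<and> nonzero_trail \<gamma> c \<and> hits ends c b"
      using c nz ht C(3) circuit_mono[of ?G ends _ F] by auto
    show "\<forall>v. imbalance (F - set (concat (map (map fst) (t # C)))) ends \<gamma> x v = 0"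
      using C(4) unfolding eq .
  qed (use C(1) in simp)
qed

section \<open>Absorbing uncovered edges into given circuits\<close>

lemma ex_uncovered_arc_at_circuits:
  assumes "graph V E ends" "connected_graph V E ends" "b \<in> V"
    and "c0 \<in> set C" "hits ends c0 b" and "E - set (concat (map (map fst) C)) \<noteq> {}"
  shows "\<exists>a c. fst a \<in> E - set (concat (map (map fst) C)) \<and> c \<in> set C \<and> hits ends c (arc_tail ends a)"
proof (rule ccontr)
  assume no: "\<not> ?thesis"
  \<comment> \<open>If no uncovered arc started in \<open>U\<close>, every edge at \<open>U\<close>
    would lie on a circuit, so \<open>U\<close> would be closed under adjacency and, containing
    \<open>b\<close>, would include all of \<open>V\<close>.\<close>
  define U where "U = {v. \<exists>c\<in>set C. hits ends c v}"
  have closed: "y \<in> U" if xy: "(x, y) \<in> adj_in V E ends" "x \<in> U" for x y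
  proof -
    obtain e where e: "e \<in> E" "ends e = (x, y) \<or> ends e = (y, x)"
      using xy(1) by (auto simp: adj_in_def)
    define a where "a = (e, ends e = (x, y))"
    have a: "fst a = e" "arc_tail ends a = x" "arc_head ends a = y"
      using e(2) by (auto simp: a_def arc_tail_def arc_head_def)
    have "e \<in> set (concat (map (map fst) C))"
      using no a e(1) xy(2) unfolding U_def by blast
    then obtain c a' where c: "c \<in> set C" "a' \<in> set c" "fst a' = e" by auto
    have "arc_tail ends a' = y \<or> arc_head ends a' = y"
      using c(3) e(2) by (auto simp: arc_tail_def arc_head_def)
    then show ?thesis using c unfolding U_def hits_def by blast
  qed
  have "b \<in> U" using assms(4,5) unfolding U_def by blast
  have reach: "v \<in> U" if "(b, v) \<in> (adj_in V E ends)\<^sup>*" for v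
    using that by (induction rule: rtrancl_induct) (use \<open>b \<in> U\<close> closed in blast)+
  obtain e where e: "e \<in> E - set (concat (map (map fst) C))" using assms(6) by blast
  then have "fst (ends e) \<in> V" using assms(1) by (simp add: graph_def)
  then have "fst (ends e) \<in> U"
    using reach assms(2,3) by (simp add: connected_graph_def)
  then obtain c where "c \<in> set C" "hits ends c (arc_tail ends (e, True))"
    by (auto simp: U_def arc_tail_def)
  moreover have "fst (e, True) \<in> E - set (concat (map (map fst) C))" using e by simp
  ultimately show False using no by blast
qed

text \<open>\<open>Q\<close> is the invariant of the uncovered edges that guarantees a further
  circuit at any of them, \<open>W\<close> the property of that circuit, \<open>P\<close> the
  property of the members that survives the insertion. It is used for inserting zero circuits into
  non-zero ones and, with trivial \<open>P\<close> and \<open>W\<close>, for building an Euler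
  tour.\<close>

lemma absorb_remaining_edges:
  assumes G: "graph V E ends" "connected_graph V E ends" "b \<in> V"
    and ext: "\<And>F a. Q F \<Longrightarrow> F \<subseteq> E \<Longrightarrow> fst a \<in> F \<Longrightarrow>
      \<exists>z. circuit F ends z \<and> arc_tail ends (hd z) = arc_tail ends a \<and> W z \<and> Q (F - fst ` set z)"
    and merge: "\<And>z c. W z \<Longrightarrow> P c \<Longrightarrow> fst ` set z \<inter> fst ` set c = {} \<Longrightarrow> P (z @ c)"
    and cong: "\<And>c c'. set c = set c' \<Longrightarrow> P c \<Longrightarrow> P c'"
    and C: "C \<noteq> []" "\<forall>c\<in>set C. circuit E ends c \<and> P c \<and> hits ends c b"
      "distinct (concat (map (map fst) C))" "Q (E - set (concat (map (map fst) C)))"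
  shows "\<exists>C'. length C' = length C \<and> (\<forall>c\<in>set C'. circuit E ends c \<and> P c \<and> hits ends c b) \<and>
    distinct (concat (map (map fst) C')) \<and> set (concat (map (map fst) C')) = E"
  using C
proof (induction "card (E - set (concat (map (map fst) C)))" arbitrary: C rule: less_induct)
  case less
  let ?S = "set (concat (map (map fst) C))"
  have fin: "finite E" using G(1) by (simp add: graph_def)
  have S: "?S \<subseteq> E"
    using less.prems(2) by (fastforce simp: circuit_def trail_iff)
  show ?case
  proof (cases "E - ?S = {}")
    case True
    then show ?thesis using less.prems S by blast
  next
    case False
    obtain c0 where c0: "c0 \<in> set C" "hits ends c0 b"
      using less.prems(1,2) by (meson list.set_sel(1))
    obtain a c where a: "fst a \<in> E - ?S" "c \<in> set C" "hits ends c (arc_tail ends a)"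
      using ex_uncovered_arc_at_circuits[OF G c0 False] by blast
    obtain z where z: "circuit (E - ?S) ends z" "arc_tail ends (hd z) = arc_tail ends a" "W z"
      "Q (E - ?S - fst ` set z)"
      using ext[OF less.prems(4) Diff_subset a(1)] by blast
    have cc: "circuit E ends c" "P c" "hits ends c b" using less.prems(2) a(2) by auto
    obtain t where t: "circuit E ends t" "set t = set c" "arc_tail ends (hd t) = arc_tail ends a"
      using circuit_from[OF cc(1) a(3)] by blast
    obtain C1 C2 where C12: "C = C1 @ c # C2" using a(2) by (auto dest: split_list)
    let ?C = "C1 @ (z @ t) # C2"
    have zS: "fst ` set z \<subseteq> E - ?S" "distinct (map fst z)" "z \<noteq> []"
      using z(1) by (auto simp: circuit_def trail_iff)
    have zt: "fst ` set z \<inter> fst ` set t = {}" using zS(1) t(2) a(2) by auto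
    have "circuit E ends (z @ t)"
      by (rule circuit_append[OF circuit_mono[OF z(1) Diff_subset] t(1)]) (use z(2) t(3) zt in auto)
    moreover have "P (z @ t)"
      by (rule merge[OF z(3) cong[OF _ cc(2)] zt]) (use t(2) in simp)
    moreover have "hits ends (z @ t) b"
      using cc(3) t(2) by (auto simp: hits_def)
    ultimately have new: "\<forall>c\<in>set ?C. circuit E ends c \<and> P c \<and> hits ends c b"
      using less.prems(2) C12 by auto
    have S': "set (concat (map (map fst) ?C)) = ?S \<union> fst ` set z"
      using t(2) C12 by auto
    have dt: "distinct (map fst t)" using t(1) by (auto simp: circuit_def trail_iff)
    define X1 X2 where "X1 = concat (map (map fst) C1)" and "X2 = concat (map (map fst) C2)"
    have cX: "concat (map (map fst) C) = X1 @ map fst c @ X2"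
      "concat (map (map fst) ?C) = X1 @ map fst z @ map fst t @ X2"
      by (simp_all add: C12 X1_def X2_def)
    have "set (map fst t) = set (map fst c)" using t(2) by simp
    moreover have "set (map fst z) \<inter> set (X1 @ map fst c @ X2) = {}"
      using zS(1) unfolding cX(1)[symmetric] by auto
    ultimately have dist: "distinct (concat (map (map fst) ?C))"
      using less.prems(3) zS(2) dt unfolding cX distinct_append set_append by blast
    have rest: "E - set (concat (map (map fst) ?C)) = E - ?S - fst ` set z"
      unfolding S' by blast
    have "fst (hd z) \<in> fst ` set z" using zS(3) by simp
    then have "E - ?S - fst ` set z \<subset> E - ?S" using zS(1) by blast
    then have "card (E - set (concat (map (map fst) ?C))) < card (E - ?S)"
      unfolding rest by (rule psubset_card_mono[OF finite_Diff[OF fin]])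
    moreover have "Q (E - set (concat (map (map fst) ?C)))"
      unfolding rest by (rule z(4))
    ultimately have "\<exists>C'. length C' = length ?C \<and> (\<forall>c\<in>set C'. circuit E ends c \<and> P c \<and> hits ends c b) \<and>
      distinct (concat (map (map fst) C')) \<and> set (concat (map (map fst) C')) = E"
      using new dist by (intro less.hyps) simp_all
    then show ?thesis unfolding C12 by simp
  qed
qed

section \<open>Euler tours\<close>

lemma degree_eq_imbalance:
  assumes "finite F"
  shows "int (degree F ends v) = imbalance F ends (\<lambda>_. True) (\<lambda>_. 1) v"
proof -
  have "int (card {e \<in> F. f e = v}) = (\<Sum>e\<in>F. point (f e) 1 v)" for f
    unfolding point_def using assms by (simp add: sum.If_cases Int_def eq_commute)
  then show ?thesis by (simp add: degree_def imbalance_def sum.distrib)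
qed

text \<open>The degree is the imbalance of the all-plus signing when every edge is non-zero, so
  \<open>imbalance_insert\<close> supplies the induction step here as well.\<close>

lemma degree_trail_parity:
  assumes "t \<noteq> []" "distinct (map fst t)"
    "successively (\<lambda>a a'. arc_head ends a = arc_tail ends a') t"
  shows "even (degree (fst ` set t) ends v) \<longleftrightarrow>
    (arc_tail ends (hd t) = v \<longleftrightarrow> arc_head ends (last t) = v)"
  using assms
proof (induction t rule: list_nonempty_induct)
  case (single a)
  have "int (degree {fst a} ends v) =
      point (arc_tail ends a) 1 v + point (arc_head ends a) 1 v"
    using imbalance_insert[of "{}" a ends "\<lambda>_. True" "\<lambda>_. 1" v]
    by (simp add: degree_eq_imbalance tail_sign_def head_sign_def imbalance_def)
  then have "even (int (degree {fst a} ends v)) \<longleftrightarrow> (arc_tail ends a = v \<longleftrightarrow> arc_head ends a = v)"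
    by (simp add: point_def)
  then show ?case by simp
next
  case (cons a t)
  have "int (degree (insert (fst a) (fst ` set t)) ends v) =
      point (arc_tail ends a) 1 v + point (arc_head ends a) 1 v + int (degree (fst ` set t) ends v)"
    using imbalance_insert[of "fst ` set t" a ends "\<lambda>_. True" "\<lambda>_. 1" v] cons.prems
    by (simp add: degree_eq_imbalance tail_sign_def head_sign_def)
  then have "even (int (degree (insert (fst a) (fst ` set t)) ends v)) \<longleftrightarrow>
      even (point (arc_tail ends a) 1 v + point (arc_head ends a) 1 v + int (degree (fst ` set t) ends v))"
    by simp
  moreover have "arc_head ends a = arc_tail ends (hd t)"
    using cons.prems(2) cons.hyps by (simp add: successively_Cons)
  moreover have "even (degree (fst ` set t) ends v) \<longleftrightarrow>
      (arc_tail ends (hd t) = v \<longleftrightarrow> arc_head ends (last t) = v)"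
    using cons by (simp add: successively_Cons)
  ultimately show ?case
    using cons.hyps by (auto simp: point_def)
qed

text \<open>The parity counterpart of \<open>extract_zero_circuit\<close>: a maximal trail uses
  every edge at its last vertex, hence has even degree there, hence is closed.\<close>

lemma extract_circuit:
  assumes "finite F" "\<And>v. even (degree F ends v)" "fst a0 \<in> F"
  shows "\<exists>z. circuit F ends z \<and> arc_tail ends (hd z) = arc_tail ends a0 \<and>
    (\<forall>v. even (degree (F - fst ` set z) ends v))"
proof -
  obtain t where t: "trail F ends t" "hd t = a0"
    and mx: "\<And>a. fst a \<in> F - fst ` set t \<Longrightarrow> arc_tail ends a \<noteq> arc_head ends (last t)"
    using maximal_trail[OF assms(1,3), of ends "\<lambda>_ _. True"] by blast
  have tF: "fst ` set t \<subseteq> F" using t(1) by (simp add: trail_iff)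
  have diff: "int (degree (F - fst ` set t) ends v) =
      int (degree F ends v) - int (degree (fst ` set t) ends v)" for v
    using assms(1) finite_subset[OF tF assms(1)] imbalance_diff[OF assms(1) tF]
    by (simp add: degree_eq_imbalance)
  have "degree (F - fst ` set t) ends (arc_head ends (last t)) = 0"
  proof -
    have "fst (ends e) \<noteq> arc_head ends (last t)" "snd (ends e) \<noteq> arc_head ends (last t)"
      if "e \<in> F - fst ` set t" for e
      using mx[of "(e, True)"] mx[of "(e, False)"] that by (auto simp: arc_tail_def)
    then have "{e \<in> F - fst ` set t. fst (ends e) = arc_head ends (last t)} = {}"
      "{e \<in> F - fst ` set t. snd (ends e) = arc_head ends (last t)} = {}" by blast+
    then show ?thesis unfolding degree_def by (simp only: card.empty)
  qed
  then have "even (degree (fst ` set t) ends (arc_head ends (last t)))"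
    using diff[of "arc_head ends (last t)"] assms(2)[of "arc_head ends (last t)"] by simp
  then have cl: "arc_head ends (last t) = arc_tail ends a0"
    using degree_trail_parity[of t ends "arc_head ends (last t)"] t by (auto simp: trail_iff)
  then have "even (degree (fst ` set t) ends v)" for v
    using degree_trail_parity[of t ends v] t by (auto simp: trail_iff)
  then have "even (int (degree (F - fst ` set t) ends v))" for v
    unfolding diff using assms(2) by simp
  moreover have "circuit F ends t" using t cl by (simp add: circuit_def)
  ultimately show ?thesis using t(2) by auto
qed

lemma ex_euler_circuit:
  assumes "eulerian V E ends" "b \<in> V" "E \<noteq> {}"
  shows "\<exists>c. circuit E ends c \<and> hits ends c b \<and> fst ` set c = E"
proof -
  have G: "graph V E ends" "connected_graph V E ends" and fin: "finite E"
    using assms(1) by (auto simp: eulerian_def graph_def)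
  have ev: "even (degree E ends v)" for v
  proof (cases "v \<in> V")
    case True
    then show ?thesis using assms(1) by (simp add: eulerian_def)
  next
    case False
    then have "{e \<in> E. fst (ends e) = v} = {}" "{e \<in> E. snd (ends e) = v} = {}"
      using G(1) by (auto simp: graph_def)
    then show ?thesis unfolding degree_def by (simp only: card.empty) simp
  qed
  have "\<exists>a0. fst a0 \<in> E \<and> arc_tail ends a0 = b"
  proof -
    obtain e where e: "e \<in> E" using assms(3) by blast
    then have "fst (ends e) \<in> V" using G(1) by (simp add: graph_def)
    then have "(b, fst (ends e)) \<in> (adj_in V E ends)\<^sup>*"
      using G(2) assms(2) by (simp add: connected_graph_def)
    then show ?thesis
    proof (cases rule: converse_rtranclE)
      case base
      then show ?thesis using e by (intro exI[of _ "(e, True)"]) (simp add: arc_tail_def)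
    next
      case (step y)
      then obtain f where f: "f \<in> E" "ends f = (b, y) \<or> ends f = (y, b)"
        by (auto simp: adj_in_def)
      then show ?thesis
        by (intro exI[of _ "(f, ends f = (b, y))"]) (auto simp: arc_tail_def)
    qed
  qed
  then obtain a0 where a0: "fst a0 \<in> E" "arc_tail ends a0 = b" by blast
  obtain z where z: "circuit E ends z" "arc_tail ends (hd z) = b"
    "\<forall>v. even (degree (E - fst ` set z) ends v)"
    using extract_circuit[OF fin ev a0(1)] a0(2) by auto
  have zz: "z \<noteq> []" "distinct (map fst z)" using z(1) by (auto simp: circuit_def trail_iff)
  have hz: "hits ends z b" using z(2) zz(1) by (auto simp: hits_def intro!: bexI[of _ "hd z"])
  have ext: "\<exists>z. circuit F ends z \<and> arc_tail ends (hd z) = arc_tail ends a \<and> True \<and>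
      (\<forall>v. even (degree (F - fst ` set z) ends v))"
    if "\<forall>v. even (degree F ends v)" "F \<subseteq> E" "fst a \<in> F" for F a
    using extract_circuit[OF finite_subset[OF that(2) fin], of ends a] that by blast
  have "\<exists>C'. length C' = length [z] \<and> (\<forall>c\<in>set C'. circuit E ends c \<and> True \<and> hits ends c b) \<and>
    distinct (concat (map (map fst) C')) \<and> set (concat (map (map fst) C')) = E"
    using z(1,3) zz hz
    by (intro absorb_remaining_edges[OF G assms(2) ext]) simp_all
  then obtain C' where "length C' = Suc 0" "\<forall>c\<in>set C'. circuit E ends c \<and> hits ends c b"
    "set (concat (map (map fst) C')) = E" by auto
  then show ?thesis by (auto simp: length_Suc_conv)
qed

text \<open>Alternating signs along an Euler tour based at \<open>b\<close> leave an imbalance at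
  \<open>b\<close> only. This makes the maximum over root imbalances one over a non-empty
  set.\<close>

lemma ex_balanced_signing:
  assumes "eulerian V E ends" "b \<in> V"
  shows "\<exists>x k. signing x \<and> imbalance E ends \<gamma> x = point b k"
proof (cases "E = {}")
  case True
  then show ?thesis
    by (intro exI[of _ "\<lambda>_. 1"] exI[of _ 0]) (auto simp: signing_def imbalance_def point_def)
next
  case False
  obtain c where c: "circuit E ends c" "hits ends c b" "fst ` set c = E"
    using ex_euler_circuit[OF assms False] by blast
  obtain t where t: "circuit E ends t" "set t = set c" "arc_tail ends (hd t) = b"
    using circuit_from[OF c(1,2)] by blast
  have "t \<noteq> []" "distinct (map fst t)" using t(1) by (auto simp: circuit_def trail_iff)
  then obtain x where x: "signing x" "alternating \<gamma> x t"
    using ex_alternating[of t 1 \<gamma>] by blast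
  have "imbalance E ends \<gamma> x = point b (tail_sign \<gamma> x (hd t) + head_sign \<gamma> x (last t))"
    using imbalance_alternating_circuit[OF t(1) x(2)] t c(3) by auto
  then show ?thesis using x(1) by blast
qed

section \<open>Decompositions and the flooding number\<close>

lemma circuit_decomposition_distinct:
  assumes "circuit_decomposition E ends C"
  shows "distinct (concat (map (map fst) C))" "set (concat (map (map fst) C)) = E"
proof -
  have c: "fst ` set c \<subseteq> E" "distinct (map fst c)" "c \<noteq> []" if "c \<in> set C" for c
    using assms that by (auto simp: circuit_decomposition_def circuit_def trail_iff)
  have unique: "i = j" if "i < length C" "j < length C" "e \<in> set (map fst (C ! i))"
    "e \<in> set (map fst (C ! j))" for i j e
  proof -
    have "e \<in> E" using c(1)[OF nth_mem[OF that(1)]] that(3) by auto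
    then have "\<exists>!i. i < length C \<and> e \<in> set (map fst (C ! i))"
      using assms unfolding circuit_decomposition_def by blast
    then show ?thesis using that by blast
  qed
  have "distinct (map (map fst) C)"
    unfolding distinct_conv_nth
  proof (intro allI impI)
    fix i j assume ij: "i < length (map (map fst) C)" "j < length (map (map fst) C)" "i \<noteq> j"
    show "map (map fst) C ! i \<noteq> map (map fst) C ! j"
    proof
      assume eq: "map (map fst) C ! i = map (map fst) C ! j"
      have "fst (hd (C ! i)) \<in> set (map fst (C ! i))"
        using c(3)[OF nth_mem] ij(1) by simp
      then show False using unique[of i j] eq ij by (metis length_map nth_map)
    qed
  qed
  \<comment> \<open>\<open>distinct_concat_iff\<close> asks for distinct lists after dropping empty
    ones; circuits are never empty.\<close>
  moreover have "removeAll [] (map (map fst) C) = map (map fst) C"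
    by (rule removeAll_id) (use c(3) in auto)
  moreover have "set ys \<inter> set zs = {}"
    if yz: "ys \<in> set (map (map fst) C)" "zs \<in> set (map (map fst) C)" "ys \<noteq> zs" for ys zs
  proof -
    obtain i j where ij: "i < length C" "ys = map fst (C ! i)" "j < length C" "zs = map fst (C ! j)"
      using yz(1,2) by (auto simp: in_set_conv_nth)
    then show ?thesis using unique[of i j] yz(3) by blast
  qed
  ultimately show "distinct (concat (map (map fst) C))"
    unfolding distinct_concat_iff using c(2) by auto
  have "e \<in> set (concat (map (map fst) C))" if "e \<in> E" for e
  proof -
    obtain i where "i < length C" "e \<in> set (map fst (C ! i))"
      using assms \<open>e \<in> E\<close> unfolding circuit_decomposition_def by blast
    then show ?thesis by (auto intro!: bexI[OF _ nth_mem])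
  qed
  then show "set (concat (map (map fst) C)) = E"
    using c(1) by auto
qed

lemma circuit_decompositionI:
  assumes "\<forall>c\<in>set C. circuit E ends c" "distinct (concat (map (map fst) C))"
    "set (concat (map (map fst) C)) = E"
  shows "circuit_decomposition E ends C"
proof -
  have less: False if "i < j" "j < length C" "e \<in> set (map fst (C ! i))" "e \<in> set (map fst (C ! j))"
    for i j e
  proof -
    let ?X = "map (map fst) C"
    have X: "?X = take j ?X @ map fst (C ! j) # drop (Suc j) ?X"
      using that(2) id_take_nth_drop[of j ?X] by simp
    have "map fst (C ! i) \<in> set (take j ?X)"
      using that(1,2) by (auto simp: in_set_conv_nth intro!: exI[of _ i])
    then have "e \<in> set (concat (take j ?X))" using that(3) unfolding set_concat by blast
    moreover have "distinct (concat (take j ?X) @ map fst (C ! j) @ concat (drop (Suc j) ?X))"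
      using assms(2) by (subst (asm) X) (simp only: concat_append concat.simps)
    ultimately show False using that(4) unfolding distinct_append set_append by blast
  qed
  have "\<exists>!i. i < length C \<and> e \<in> set (map fst (C ! i))" if "e \<in> E" for e
  proof -
    have "e \<in> set (concat (map (map fst) C))" using that assms(3) by simp
    then obtain c where "c \<in> set C" "e \<in> set (map fst c)" by auto
    then obtain i where "i < length C" "e \<in> set (map fst (C ! i))"
      unfolding in_set_conv_nth[of c] by blast
    then show ?thesis using less by (metis linorder_neqE_nat)
  qed
  then show ?thesis using assms(1) unfolding circuit_decomposition_def by blast
qed

text \<open>Decompositions give signings with twice as much imbalance at \<open>b\<close>.
  Conversely an optimal signing gives \<open>m\<close> non-zero circuits through \<open>b\<close>,
  and the uncovered, fully balanced edges split into zero circuits whose insertion preserves the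
  weights.\<close>

lemma flooding_number_eq:
  assumes "eulerian V E ends" "b \<in> V" "signing x" "imbalance E ends \<gamma> x = point b (2 * int m)"
    and max: "\<And>y j. signing y \<Longrightarrow> imbalance E ends \<gamma> y = point b j \<Longrightarrow> j \<le> 2 * int m"
  shows "flooding_number V E ends \<gamma> b = m"
proof -
  have G: "graph V E ends" "connected_graph V E ends" and fin: "finite E"
    using assms(1) by (auto simp: eulerian_def graph_def)
  define S where "S = {length C | C. circuit_decomposition E ends C \<and>
                 (\<forall>c\<in>set C. nonzero_trail \<gamma> c \<and> hits ends c b)}"
  have le: "n \<le> m" if n: "n \<in> S" for n
  proof -
    obtain C where C: "n = length C" "circuit_decomposition E ends C"
      "\<forall>c\<in>set C. nonzero_trail \<gamma> c \<and> hits ends c b"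
      using n unfolding S_def by blast
    have "\<forall>c\<in>set C. circuit E ends c \<and> nonzero_trail \<gamma> c \<and> hits ends c b"
      using C(2,3) unfolding circuit_decomposition_def by blast
    then obtain y where "signing y" "\<forall>v. imbalance E ends \<gamma> y v = point b (2 * int (length C)) v"
      using signing_of_circuits[OF circuit_decomposition_distinct(1)[OF C(2)], of E ends \<gamma> b]
      unfolding circuit_decomposition_distinct(2)[OF C(2)] by blast
    then have "2 * int (length C) \<le> 2 * int m"
      by (intro max) auto
    then show ?thesis using C(1) by simp
  qed
  have "m \<in> S" if "m > 0"
  proof -
    have im: "imbalance E ends \<gamma> x v = point b (2 * int m) v" for v
      by (simp add: assms(4))
    obtain C where C: "length C = m" "distinct (concat (map (map fst) C))"
      "\<forall>c\<in>set C. circuit E ends c \<and> nonzero_trail \<gamma> c \<and> hits ends c b"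
      "\<forall>v. imbalance (E - set (concat (map (map fst) C))) ends \<gamma> x v = 0"
      using extract_nonzero_circuits[OF fin assms(3) im] by blast
    have ext: "\<exists>z. circuit F ends z \<and> arc_tail ends (hd z) = arc_tail ends a \<and> \<not> nonzero_trail \<gamma> z \<and>
        (\<forall>v. imbalance (F - fst ` set z) ends \<gamma> x v = 0)"
      if "\<forall>v. imbalance F ends \<gamma> x v = 0" "F \<subseteq> E" "fst a \<in> F" for F a
      using extract_zero_circuit[OF finite_subset[OF that(2) fin] assms(3), of ends \<gamma> a] that by blast
    have "C \<noteq> []" using C(1) \<open>m > 0\<close> by auto
    then have "\<exists>C'. length C' = length C \<and>
      (\<forall>c\<in>set C'. circuit E ends c \<and> nonzero_trail \<gamma> c \<and> hits ends c b) \<and>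
      distinct (concat (map (map fst) C')) \<and> set (concat (map (map fst) C')) = E"
      by (intro absorb_remaining_edges[OF G assms(2) ext _ _ _ C(3) C(2) C(4)])
        (auto simp: nonzero_trail_append dest: nonzero_trail_cong)
    then obtain C' where C': "length C' = length C"
      "\<forall>c\<in>set C'. circuit E ends c \<and> nonzero_trail \<gamma> c \<and> hits ends c b"
      "distinct (concat (map (map fst) C'))" "set (concat (map (map fst) C')) = E" by blast
    have "circuit_decomposition E ends C'"
      by (rule circuit_decompositionI) (use C' in auto)
    then have "m = length C' \<and> circuit_decomposition E ends C' \<and>
        (\<forall>c\<in>set C'. nonzero_trail \<gamma> c \<and> hits ends c b)"
      using C'(1,2) C(1) by simp
    then show ?thesis unfolding S_def by blast
  qed
  then have "(if S = {} then 0 else Max S) = m"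
  proof (cases "m > 0")
    case True
    have "finite S" using le by (meson finite_nat_set_iff_bounded_le)
    then show ?thesis using \<open>m > 0 \<Longrightarrow> m \<in> S\<close> True le by (auto intro!: Max_eqI)
  next
    \<comment> \<open>For \<open>m = 0\<close> a suitable decomposition need not exist; the default
      value 0 in \<open>flooding_number\<close> then agrees with \<open>m\<close>.\<close>
    case False
    then have "S \<subseteq> {0}" using le by auto
    then have "S = {} \<or> S = {0}" by blast
    then show ?thesis using False by auto
  qed
  then show ?thesis unfolding flooding_number_def S_def Let_def .
qed

section \<open>Contracting to the root\<close>

text \<open>Only the incidence map changes, so the same signings apply before and after. Edges
  inside \<open>X\<close> become loops at \<open>b\<close>, and the other vertices of
  \<open>X\<close> become isolated.\<close>

definition contract :: "'v set \<Rightarrow> 'v \<Rightarrow> ('e \<Rightarrow> 'v \<times> 'v) \<Rightarrow> 'e \<Rightarrow> 'v \<times> 'v" where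
  "contract X b ends e =
     (if fst (ends e) \<in> X then b else fst (ends e), if snd (ends e) \<in> X then b else snd (ends e))"

lemma sum_point: "finite Y \<Longrightarrow> (\<Sum>v\<in>Y. point p c v) = (if p \<in> Y then c else 0)"
  by (simp add: point_def)

lemma sum_imbalance:
  assumes "finite Y"
  shows "(\<Sum>v\<in>Y. imbalance E ends \<gamma> x v) =
    (\<Sum>e\<in>E. (if fst (ends e) \<in> Y then x e else 0)
      + (if snd (ends e) \<in> Y then if \<gamma> e then x e else - x e else 0))"
  unfolding imbalance_def by (subst sum.swap) (simp only: sum.distrib sum_point[OF assms])

lemma imbalance_contract_root:
  assumes "finite X" "b \<in> X"
  shows "imbalance E (contract X b ends) \<gamma> x b = (\<Sum>v\<in>X. imbalance E ends \<gamma> x v)"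
  unfolding sum_imbalance[OF assms(1)] unfolding imbalance_def
  using assms(2) by (intro sum.cong) (auto simp: contract_def point_def)

lemma imbalance_contract_outside:
  assumes "v \<notin> X" "b \<in> X"
  shows "imbalance E (contract X b ends) \<gamma> x v = imbalance E ends \<gamma> x v"
  unfolding imbalance_def using assms
  by (intro sum.cong) (auto simp: contract_def point_def)

lemma imbalance_contract_inside:
  assumes "v \<in> X" "v \<noteq> b"
  shows "imbalance E (contract X b ends) \<gamma> x v = 0"
  unfolding imbalance_def using assms
  by (intro sum.neutral) (auto simp: contract_def point_def)

lemma contract_insert:
  "b \<in> X \<Longrightarrow> contract (insert v X) b ends = contract {b, v} b (contract X b ends)"
  by (rule ext) (auto simp: contract_def)

lemma contract_root: "contract {b} b ends = ends"
  by (rule ext) (auto simp: contract_def)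

lemma feasible_contract:
  assumes "finite X" "b \<in> X" "feasible E ends \<gamma> (point b j)"
  shows "feasible E (contract X b ends) \<gamma> (point b j)"
proof -
  obtain x where x: "signing x" "imbalance E ends \<gamma> x = point b j"
    using assms(3) by (auto simp: feasible_def)
  have "imbalance E (contract X b ends) \<gamma> x v = point b j v" for v
  proof -
    consider "v = b" | "v \<in> X" "v \<noteq> b" | "v \<notin> X" by blast
    then show ?thesis
    proof cases
      case 1
      have "(\<Sum>v\<in>X. point b j v) = j"
        using assms(1,2) by (simp add: sum_point)
      then show ?thesis
        using imbalance_contract_root[OF assms(1,2), of E ends \<gamma> x] x(2) 1 by (simp add: point_def)
    next
      case 2
      then show ?thesis using imbalance_contract_inside[of v X b E ends \<gamma> x] by (simp add: point_def)
    next
      case 3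
      then show ?thesis using imbalance_contract_outside[OF 3 assms(2), of E ends \<gamma> x] x(2) by simp
    qed
  qed
  then have "imbalance E (contract X b ends) \<gamma> x = point b j" by blast
  then show ?thesis using x(1) unfolding feasible_def by blast
qed

text \<open>A shift at \<open>v\<close> is undone by reversing all half-edges at \<open>v\<close>.
  In terms of \<open>x\<close> this means negating exactly the edges whose first end is
  \<open>v\<close>; a loop at \<open>v\<close> has both half-edges reversed, in accordance with
  shifts leaving loops alone.\<close>

lemma unshift_signing:
  assumes "signing y"
  shows "\<exists>x. signing x \<and> (\<forall>u. imbalance E ends \<gamma> x u =
    (if u = v then -1 else 1) * imbalance E ends (shift_at E ends v \<gamma>) y u)"
proof -
  define x where "x = (\<lambda>e. if fst (ends e) = v then - y e else y e)"
  have "signing x" using assms by (auto simp: signing_def x_def)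
  moreover have "imbalance E ends \<gamma> x u =
      (if u = v then -1 else 1) * imbalance E ends (shift_at E ends v \<gamma>) y u" for u
    unfolding imbalance_def sum_distrib_left
    by (rule sum.cong) (auto simp: x_def point_def shift_at_def)
  ultimately show ?thesis by blast
qed

lemma shift_at_twice: "shift_at E ends v (shift_at E ends v \<gamma>) = \<gamma>"
  by (rule ext) (auto simp: shift_at_def)

lemma feasible_shift_at:
  assumes "feasible E ends \<gamma> (point b j)"
  shows "feasible E ends (shift_at E ends v \<gamma>) (point b j)"
proof -
  obtain y where y: "signing y" "imbalance E ends \<gamma> y = point b j"
    using assms by (auto simp: feasible_def)
  obtain x where x: "signing x" "\<And>u. imbalance E ends (shift_at E ends v \<gamma>) x u =
      (if u = v then -1 else 1) * point b j u"
    using unshift_signing[OF y(1), of E ends "shift_at E ends v \<gamma>" v]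
    unfolding shift_at_twice y(2) by blast
  \<comment> \<open>For \<open>v = b\<close> the root imbalance has become \<open>- j\<close>, which
    negating all signs repairs.\<close>
  show ?thesis
  proof (cases "v = b")
    case True
    have "imbalance E ends (shift_at E ends v \<gamma>) (\<lambda>e. - x e) = point b j"
      using x(2) True by (intro HOL.ext) (auto simp: imbalance_uminus point_def)
    moreover have "signing (\<lambda>e. - x e)" using x(1) by (fastforce simp: signing_def)
    ultimately show ?thesis unfolding feasible_def by blast
  next
    case False
    have "imbalance E ends (shift_at E ends v \<gamma>) x = point b j"
      using x(2) False by (intro HOL.ext) (auto simp: point_def)
    then show ?thesis using x(1) unfolding feasible_def by blast
  qed
qed

lemma feasible_shifting:
  assumes "is_shifting V E ends \<gamma> \<gamma>'" "feasible E ends \<gamma> (point b j)"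
  shows "feasible E ends \<gamma>' (point b j)"
  using assms by (induction rule: is_shifting.induct) (auto intro: feasible_shift_at)

text \<open>Contraction neither creates nor destroys loops at a vertex outside \<open>X\<close>. So
  a shift found in the contracted graph is a shift of the original one, as the certificate
  requires.\<close>

lemma shift_at_contract:
  assumes "v \<notin> X" "b \<in> X"
  shows "shift_at E (contract X b ends) v \<gamma> = shift_at E ends v \<gamma>"
  using assms by (intro HOL.ext) (auto simp: shift_at_def contract_def)

lemma adj_in_contract:
  assumes "W \<inter> X = {}" "b \<in> X"
  shows "adj_in W E (contract X b ends) = adj_in W E ends"
proof -
  have "contract X b ends e = (x, y) \<longleftrightarrow> ends e = (x, y)" if "x \<in> W" "y \<in> W" for e x y
    using assms that by (cases "ends e") (auto simp: contract_def)
  then show ?thesis unfolding adj_in_def by blast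
qed

section \<open>Reversing edges at the root\<close>

context rooted_signed_graph
begin

text \<open>Reversing a negative arc at the root gains 2 there, paid for at its head.\<close>

lemma critical_of_wrong_arc:
  assumes "signing x" "imb x = point r k" "fst a \<in> E" "arc_tail ends a = r" "tail_sign \<gamma> x a = -1"
  shows "\<exists>\<rho>. (\<rho> = 1 \<or> \<rho> = -1) \<and> critical (arc_head ends a) \<rho>"
proof -
  have "imb (x(fst a := - x (fst a))) =
      (\<lambda>u. point r (k + 2) u + point (arc_head ends a) (2 * - head_sign \<gamma> x a) u)"
    unfolding imb_flip[OF assms(3)] assms by (rule HOL.ext) (simp add: point_def)
  then have "critical (arc_head ends a) (- head_sign \<gamma> x a)"
    using signing_flip[OF assms(1)] unfolding critical_def feasible_def by blast
  moreover have "- head_sign \<gamma> x a = 1 \<or> - head_sign \<gamma> x a = -1"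
    using assms(5) by (simp add: head_sign_eq)
  ultimately show ?thesis by blast
qed

lemma joint_of_wrong_arcs:
  assumes "signing x" "imb x = point r k" "fst a \<noteq> fst a'"
    and a: "fst a \<in> E" "arc_tail ends a = r" "tail_sign \<gamma> x a = -1"
    and a': "fst a' \<in> E" "arc_tail ends a' = r" "tail_sign \<gamma> x a' = -1"
  shows "\<exists>\<rho> \<rho>'. (\<rho> = 1 \<or> \<rho> = -1) \<and> (\<rho>' = 1 \<or> \<rho>' = -1) \<and>
    joint (arc_head ends a) \<rho> (arc_head ends a') \<rho>'"
proof -
  let ?y = "x(fst a := - x (fst a))"
  have y: "tail_sign \<gamma> ?y a' = -1" "head_sign \<gamma> ?y a' = head_sign \<gamma> x a'"
    using assms(3) a'(3) by (auto simp: tail_sign_def head_sign_def)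
  have "imb (?y(fst a' := - ?y (fst a'))) =
      (\<lambda>u. point r (k + 4) u + point (arc_head ends a) (2 * - head_sign \<gamma> x a) u
        + point (arc_head ends a') (2 * - head_sign \<gamma> x a') u)"
    unfolding imb_flip[OF a'(1)] imb_flip[OF a(1)] y a a' assms(2)
    by (rule HOL.ext) (simp add: point_def)
  then have "joint (arc_head ends a) (- head_sign \<gamma> x a) (arc_head ends a') (- head_sign \<gamma> x a')"
    using signing_flip[OF signing_flip[OF assms(1)]] unfolding joint_def feasible_def by blast
  moreover have "- head_sign \<gamma> x a = 1 \<or> - head_sign \<gamma> x a = -1"
    "- head_sign \<gamma> x a' = 1 \<or> - head_sign \<gamma> x a' = -1"
    using a(3) a'(3) by (simp_all add: head_sign_eq)
  ultimately show ?thesis by blast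
qed

text \<open>A negative non-zero loop at the root could be reversed for a gain of 4 without affecting
  any other vertex.\<close>

lemma root_loop_positive:
  assumes "signing x" "imb x = point r k" "e \<in> E" "ends e = (r, r)" "\<gamma> e"
  shows "x e = 1"
proof (rule ccontr)
  assume "x e \<noteq> 1"
  then have xe: "x e = -1" using assms(1) by (auto simp: signing_def)
  have "imb (x(fst (e, True) := - x (fst (e, True)))) = point r (k + 4)"
    using assms(3) by (subst imb_flip) (auto simp: assms xe arc_tail_def arc_head_def tail_sign_def
        head_sign_def point_def)
  then have "feas (point r (k + 4))"
    using signing_flip[OF assms(1)] unfolding feasible_def by blast
  then show False using root_max by fastforce
qed

end

section \<open>Components and boundary signs\<close>

context rooted_signed_graph
begin

text \<open>Induction along a path in \<open>W\<close>: \<open>bicritical_neighbour\<close> and the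
  assumption on \<open>W\<close> make the next vertex bicritical, \<open>not_joint_adjacent\<close>
  handles the new edge, and \<open>not_joint_trans\<close> links it to the path so far.\<close>

lemma not_joint_component:
  assumes "r \<notin> W" "\<And>v \<tau>. v \<in> W \<Longrightarrow> \<tau> = 1 \<or> \<tau> = -1 \<Longrightarrow> critical v \<tau> \<Longrightarrow> bicritical v"
    and "bicritical u" "(u, w) \<in> (adj_in W E ends)\<^sup>*"
  shows "bicritical w \<and>
    (\<forall>\<alpha> \<beta>. (\<alpha> = 1 \<or> \<alpha> = -1) \<longrightarrow> (\<beta> = 1 \<or> \<beta> = -1) \<longrightarrow> \<not> joint u \<alpha> w \<beta>)"
  using assms(4)
proof (induction rule: rtrancl_induct)
  case base
  then show ?case using assms(3) not_joint_self by blast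
next
  case (step v w)
  obtain e where e: "e \<in> E" "ends e = (v, w) \<or> ends e = (w, v)" and W: "v \<in> W" "w \<in> W"
    using step.hyps(2) by (auto simp: adj_in_def)
  define a where "a = (e, ends e = (v, w))"
  have a: "fst a \<in> E" "arc_tail ends a = v" "arc_head ends a = w"
    using e by (auto simp: a_def arc_tail_def arc_head_def)
  show ?case
  proof (cases "v = w")
    case True
    then show ?thesis using step.IH by blast
  next
    case False
    have v: "bicritical v" using step.IH by blast
    obtain \<rho> where "\<rho> = 1 \<or> \<rho> = -1" "critical w \<rho>"
      using bicritical_neighbour[OF v a(1,2)] a(3) False by auto
    then have w: "bicritical w" using assms(2)[OF W(2)] by blast
    have "\<not> joint u \<alpha> w \<beta>" if "\<alpha> = 1 \<or> \<alpha> = -1" "\<beta> = 1 \<or> \<beta> = -1" for \<alpha> \<beta>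
    proof (rule not_joint_trans[OF assms(3) v w _ _ that])
      show "\<not> joint u \<alpha> v \<beta>" if "\<alpha> = 1 \<or> \<alpha> = -1" "\<beta> = 1 \<or> \<beta> = -1" for \<alpha> \<beta>
        using step.IH that by blast
      show "\<not> joint v \<alpha> w \<beta>" if "\<alpha> = 1 \<or> \<alpha> = -1" "\<beta> = 1 \<or> \<beta> = -1" for \<alpha> \<beta>
        using not_joint_adjacent[OF v w False a that] .
    qed
    then show ?thesis using w by blast
  qed
qed

text \<open>Reversing two different negative arcs at the root would make their heads jointly
  critical, which is impossible within one component.\<close>

lemma wrong_arcs_same_component:
  assumes "r \<notin> W" "\<And>v \<tau>. v \<in> W \<Longrightarrow> \<tau> = 1 \<or> \<tau> = -1 \<Longrightarrow> critical v \<tau> \<Longrightarrow> bicritical v"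
    and x: "signing x" "imb x = point r k"
    and a: "fst a \<in> E" "arc_tail ends a = r" "tail_sign \<gamma> x a = -1" "arc_head ends a \<in> W"
    and a': "fst a' \<in> E" "arc_tail ends a' = r" "tail_sign \<gamma> x a' = -1"
    and reach: "(arc_head ends a, arc_head ends a') \<in> (adj_in W E ends)\<^sup>*"
  shows "fst a = fst a'"
proof (rule ccontr)
  assume ne: "fst a \<noteq> fst a'"
  have bic: "bicritical (arc_head ends a)"
    using critical_of_wrong_arc[OF x a(1-3)] assms(2)[OF a(4)] by blast
  have "bicritical (arc_head ends a') \<and> (\<forall>\<alpha> \<beta>. (\<alpha> = 1 \<or> \<alpha> = -1) \<longrightarrow> (\<beta> = 1 \<or> \<beta> = -1) \<longrightarrow>
      \<not> joint (arc_head ends a) \<alpha> (arc_head ends a') \<beta>)"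
    by (rule not_joint_component[OF assms(1) _ bic reach]) (rule assms(2))
  then show False
    using joint_of_wrong_arcs[OF x ne a(1-3) a'] by blast
qed

end

section \<open>Components of \<open>G - X\<close> and the edges leaving \<open>X\<close>\<close>

lemma adj_in_sym: "sym ((adj_in W E ends)\<^sup>*)"
  by (rule sym_rtrancl) (auto simp: sym_def adj_in_def)

lemma components_minus_subset: "Y \<in> components_minus V E ends X \<Longrightarrow> Y \<subseteq> V - X"
proof -
  assume "Y \<in> components_minus V E ends X"
  then obtain u where u: "u \<in> V - X" "Y = {w. (u, w) \<in> (adj_in (V - X) E ends)\<^sup>*}"
    by (auto simp: components_minus_def)
  have "w \<in> V - X" if "(u, w) \<in> (adj_in (V - X) E ends)\<^sup>*" for w
    using that u(1) by (induction rule: rtrancl_induct) (auto simp: adj_in_def)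
  then show ?thesis using u(2) by blast
qed

lemma components_minus_connected:
  assumes "Y \<in> components_minus V E ends X" "u \<in> Y"
  shows "Y = {w. (u, w) \<in> (adj_in (V - X) E ends)\<^sup>*}"
proof -
  obtain u0 where u0: "Y = {w. (u0, w) \<in> (adj_in (V - X) E ends)\<^sup>*}"
    using assms(1) by (auto simp: components_minus_def)
  have "(u0, u) \<in> (adj_in (V - X) E ends)\<^sup>*" using assms(2) u0 by blast
  moreover have "(u, u0) \<in> (adj_in (V - X) E ends)\<^sup>*"
    using calculation adj_in_sym by (metis symD)
  ultimately show ?thesis unfolding u0 by (blast intro: rtrancl_trans)
qed

lemma components_minus_disjoint:
  assumes "Y \<in> components_minus V E ends X" "Z \<in> components_minus V E ends X" "Y \<noteq> Z"
  shows "Y \<inter> Z = {}"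
  using components_minus_connected[OF assms(1)] components_minus_connected[OF assms(2)] assms(3)
  by blast

lemma ex_component: "u \<in> V - X \<Longrightarrow> \<exists>Y\<in>components_minus V E ends X. u \<in> Y"
  unfolding components_minus_def by blast

lemma component_closed:
  assumes "Y \<in> components_minus V E ends X" "u \<in> Y" "w \<in> V - X"
    "e \<in> E" "ends e = (u, w) \<or> ends e = (w, u)"
  shows "w \<in> Y"
proof -
  have "u \<in> V - X" using components_minus_subset[OF assms(1)] assms(2) by blast
  then have "(u, w) \<in> adj_in (V - X) E ends" using assms(3-5) by (auto simp: adj_in_def)
  then show ?thesis using components_minus_connected[OF assms(1,2)] by blast
qed

text \<open>Meaningful only on \<open>delta E ends X\<close>, where it is the sign at the end in \<open>X\<close>.\<close>

definition boundary_sign ::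
  "('e \<Rightarrow> 'v \<times> 'v) \<Rightarrow> ('e \<Rightarrow> bool) \<Rightarrow> ('e \<Rightarrow> int) \<Rightarrow> 'v set \<Rightarrow> 'e \<Rightarrow> int" where
  "boundary_sign ends \<gamma> x X e = (if fst (ends e) \<in> X \<or> \<gamma> e then x e else - x e)"

definition wrong_edges ::
  "'e set \<Rightarrow> ('e \<Rightarrow> 'v \<times> 'v) \<Rightarrow> ('e \<Rightarrow> bool) \<Rightarrow> ('e \<Rightarrow> int) \<Rightarrow> 'v set \<Rightarrow> 'e set" where
  "wrong_edges E ends \<gamma> x X = {e \<in> delta E ends X. boundary_sign ends \<gamma> x X e = -1}"

lemma sum_card_filter: "finite E \<Longrightarrow> (\<Sum>e\<in>E. if P e then c else 0) = c * int (card {e \<in> E. P e})"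
  by (simp add: sum.If_cases Int_def)

text \<open>Zero edges inside \<open>X\<close> cancel, non-zero ones count twice, and a boundary
  edge contributes 1, or 1 - 2 if it is wrong.\<close>

lemma sum_imbalance_boundary:
  assumes "finite E" "finite X" "signing x"
  shows "(\<Sum>v\<in>X. imbalance E ends \<gamma> x v) =
    (\<Sum>e\<in>{e \<in> E_in E ends X. \<gamma> e}. 2 * x e)
      + int (card (delta E ends X)) - 2 * int (card (wrong_edges E ends \<gamma> x X))"
proof -
  let ?P = "\<lambda>e. fst (ends e) \<in> X \<and> snd (ends e) \<in> X \<and> \<gamma> e"
  let ?D = "\<lambda>e. (fst (ends e) \<in> X) \<noteq> (snd (ends e) \<in> X)"
  let ?W = "\<lambda>e. ?D e \<and> boundary_sign ends \<gamma> x X e = -1"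
  have "(\<Sum>v\<in>X. imbalance E ends \<gamma> x v) =
      (\<Sum>e\<in>E. (if ?P e then 2 * x e else 0) + (if ?D e then 1 else 0) - (if ?W e then 2 else 0))"
    unfolding sum_imbalance[OF assms(2)]
  proof (rule sum.cong[OF HOL.refl])
    fix e
    have "x e = 1 \<or> x e = -1" using assms(3) by (auto simp: signing_def)
    then show "(if fst (ends e) \<in> X then x e else 0)
        + (if snd (ends e) \<in> X then if \<gamma> e then x e else - x e else 0) =
      (if ?P e then 2 * x e else 0) + (if ?D e then 1 else 0) - (if ?W e then 2 else 0)"
      by (auto simp: boundary_sign_def)
  qed
  also have "\<dots> = (\<Sum>e\<in>E. if ?P e then 2 * x e else 0) + int (card {e \<in> E. ?D e})
      - 2 * int (card {e \<in> E. ?W e})"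
    by (simp only: sum.distrib sum_subtractf sum_card_filter[OF assms(1)] mult_1)
  also have "(\<Sum>e\<in>E. if ?P e then 2 * x e else 0) = (\<Sum>e\<in>{e \<in> E. ?P e}. 2 * x e)"
    by (rule sum.inter_filter[OF assms(1), symmetric])
  finally show ?thesis
    by (simp add: E_in_def delta_def wrong_edges_def conj_assoc)
qed

text \<open>The signs at the half-edges in \<open>Y\<close> sum to 0. Modulo 4, an edge contributes
  2 for being non-zero, -1 for lying on the boundary and 2 for being wrong, whatever its actual
  sign. So \<open>2 * p - d + 2 * w\<close> is divisible by 4, where \<open>p\<close>,
  \<open>d\<close>, \<open>w\<close> count these edges; this is the origin of
  \<open>card (delta E ends Y) div 2\<close> in \<open>gamma_odd\<close>.\<close>

lemma wrong_edges_parity: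
  assumes "finite E" "finite Y" "signing x" "Y \<inter> X = {}" "delta E ends Y \<subseteq> delta E ends X"
    and "\<And>v. v \<in> Y \<Longrightarrow> imbalance E ends \<gamma> x v = 0"
  shows "odd (card (wrong_edges E ends \<gamma> x X \<inter> delta E ends Y)) \<longleftrightarrow> gamma_odd E ends \<gamma> Y"
proof -
  let ?P = "\<lambda>e. (fst (ends e) \<in> Y \<or> snd (ends e) \<in> Y) \<and> \<gamma> e"
  let ?D = "\<lambda>e. (fst (ends e) \<in> Y) \<noteq> (snd (ends e) \<in> Y)"
  let ?W = "\<lambda>e. ?D e \<and> boundary_sign ends \<gamma> x X e = -1"
  let ?t = "\<lambda>e. (if fst (ends e) \<in> Y then x e else 0)
    + (if snd (ends e) \<in> Y then if \<gamma> e then x e else - x e else 0)"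
  let ?s = "\<lambda>e. (if ?P e then 2 else 0) - (if ?D e then 1 else 0) + (if ?W e then 2 else 0)"
  have "(4::int) dvd (\<Sum>e\<in>E. ?t e - ?s e)"
  proof (rule dvd_sum)
    fix e assume e: "e \<in> E"
    have pm: "x e = 1 \<or> x e = -1" using assms(3) by (auto simp: signing_def)
    show "(4::int) dvd ?t e - ?s e"
    proof (cases "?D e")
      case True
      then have "(fst (ends e) \<in> X) \<noteq> (snd (ends e) \<in> X)"
        using assms(5) e by (auto simp: delta_def)
      then consider "fst (ends e) \<in> Y" "snd (ends e) \<notin> Y" "fst (ends e) \<notin> X" "snd (ends e) \<in> X"
        | "snd (ends e) \<in> Y" "fst (ends e) \<notin> Y" "snd (ends e) \<notin> X" "fst (ends e) \<in> X"
        using True assms(4) by blast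
      then show ?thesis using pm by cases (auto simp: boundary_sign_def)
    next
      case False
      then show ?thesis using pm by auto
    qed
  qed
  moreover have "(\<Sum>e\<in>E. ?t e) = 0"
    unfolding sum_imbalance[OF assms(2), symmetric] using assms(6) by simp
  moreover have "(\<Sum>e\<in>E. ?s e) =
      2 * int (card {e \<in> E. ?P e}) - int (card {e \<in> E. ?D e}) + 2 * int (card {e \<in> E. ?W e})"
    by (simp only: sum.distrib sum_subtractf sum_card_filter[OF assms(1)] mult_1)
  ultimately have dvd4: "(4::int) dvd
      2 * int (card {e \<in> E. ?P e}) - int (card {e \<in> E. ?D e}) + 2 * int (card {e \<in> E. ?W e})"
    by (simp add: sum_subtractf)
  have P: "wcount \<gamma> (E_in E ends Y \<union> delta E ends Y) = card {e \<in> E. ?P e}"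
    unfolding wcount_def E_in_def delta_def by (rule arg_cong[where f = card]) auto
  have W: "wrong_edges E ends \<gamma> x X \<inter> delta E ends Y = {e \<in> E. ?W e}"
    using assms(5) by (auto simp: wrong_edges_def delta_def)
  have D: "delta E ends Y = {e \<in> E. ?D e}" by (simp add: delta_def)
  have arith: "odd w \<longleftrightarrow> odd p \<noteq> odd (d div 2)"
    if "(4::int) dvd 2 * int p - int d + 2 * int w" for p d w :: nat
    using that by presburger
  show ?thesis
    unfolding gamma_odd_def P W unfolding D by (rule arith[OF dvd4])
qed

text \<open>Every edge leaving \<open>X\<close> has its other end in exactly one component of
  \<open>G - X\<close>.\<close>

lemma card_wrong_edges:
  assumes "graph V E ends"
  shows "card (wrong_edges E ends \<gamma> x X) =
    (\<Sum>Y\<in>components_minus V E ends X. card (wrong_edges E ends \<gamma> x X \<inter> delta E ends Y))"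
proof -
  let ?W = "wrong_edges E ends \<gamma> x X" and ?C = "components_minus V E ends X"
  have fin: "finite ?C" "finite ?W"
    using assms by (simp_all add: graph_def components_minus_def wrong_edges_def delta_def)
  have "?W \<subseteq> (\<Union>Y\<in>?C. ?W \<inter> delta E ends Y)"
  proof
    fix e assume e: "e \<in> ?W"
    then have "e \<in> E" "(fst (ends e) \<in> X) \<noteq> (snd (ends e) \<in> X)"
      by (auto simp: wrong_edges_def delta_def)
    moreover from this have "fst (ends e) \<in> V" "snd (ends e) \<in> V"
      using assms by (auto simp: graph_def)
    ultimately obtain u w where u: "u \<in> V - X" "w \<in> X" "ends e = (u, w) \<or> ends e = (w, u)" "e \<in> E"
      by (cases "ends e") auto
    obtain Y where Y: "Y \<in> ?C" "u \<in> Y" using ex_component[OF u(1)] by blast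
    have "w \<notin> Y" using components_minus_subset[OF Y(1)] u(2) by blast
    then have "e \<in> delta E ends Y" using u Y(2) by (auto simp: delta_def)
    then show "e \<in> (\<Union>Y\<in>?C. ?W \<inter> delta E ends Y)" using e Y(1) by blast
  qed
  then have "?W = (\<Union>Y\<in>?C. ?W \<inter> delta E ends Y)" by blast
  moreover have "(?W \<inter> delta E ends Y) \<inter> (?W \<inter> delta E ends Z) = {}"
    if "Y \<in> ?C" "Z \<in> ?C" "Y \<noteq> Z" for Y Z
  proof -
    have "Y \<inter> X = {}" "Z \<inter> X = {}" "Y \<inter> Z = {}"
      using components_minus_subset that components_minus_disjoint[OF that] by blast+
    then show ?thesis by (auto simp: wrong_edges_def delta_def)
  qed
  ultimately have "card ?W = card (\<Union>Y\<in>?C. ?W \<inter> delta E ends Y)" by simp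
  also have "\<dots> = (\<Sum>Y\<in>?C. card (?W \<inter> delta E ends Y))"
    using fin \<open>\<And>Z Y. Y \<in> ?C \<Longrightarrow> Z \<in> ?C \<Longrightarrow> Y \<noteq> Z \<Longrightarrow> _\<close> by (intro card_UN_disjoint) auto
  finally show ?thesis .
qed

lemma delta_component_subset:
  assumes "graph V E ends" "Y \<in> components_minus V E ends X"
  shows "delta E ends Y \<subseteq> delta E ends X"
proof
  fix e assume "e \<in> delta E ends Y"
  then have e: "e \<in> E" "(fst (ends e) \<in> Y) \<noteq> (snd (ends e) \<in> Y)" by (auto simp: delta_def)
  then have V: "fst (ends e) \<in> V" "snd (ends e) \<in> V" using assms(1) by (auto simp: graph_def)
  obtain u w where u: "u \<in> Y" "w \<notin> Y" "w \<in> V" "ends e = (u, w) \<or> ends e = (w, u)"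
    using e(2) V by (cases "ends e") auto
  have "w \<in> X" using component_closed[OF assms(2) u(1) _ e(1) u(4)] u(2,3) by blast
  moreover have "u \<notin> X" using components_minus_subset[OF assms(2)] u(1) by blast
  ultimately show "e \<in> delta E ends X" using u(4) e(1) by (auto simp: delta_def)
qed

context rooted_signed_graph
begin

text \<open>The merged root has the sum of the imbalances of \<open>r\<close> and \<open>v\<close>.
  When the only admissible payment at \<open>v\<close> is positive, the shift reverses the sign at
  \<open>v\<close> first, so that payment and gain cancel in either case;
  \<open>one_sided_critical_bound\<close> then says that no other combination exceeds
  \<open>k\<close>.\<close>

lemma merge_one_sided_critical:
  assumes "\<epsilon> = 1 \<or> \<epsilon> = -1" "v \<noteq> r" "critical v (- \<epsilon>)" "\<not> critical v \<epsilon>"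
    and "feasible E (contract {r, v} r ends) (if \<epsilon> = 1 then \<gamma> else shift_at E ends v \<gamma>) (point r j)"
  shows "j \<le> k"
proof -
  let ?\<gamma> = "if \<epsilon> = 1 then \<gamma> else shift_at E ends v \<gamma>"
  obtain y where y: "signing y" "imbalance E (contract {r, v} r ends) ?\<gamma> y = point r j"
    using assms(5) unfolding feasible_def by blast
  have "\<exists>x. signing x \<and> (\<forall>u. imb x u = (if u = v then \<epsilon> else 1) * imbalance E ends ?\<gamma> y u)"
  proof (cases "\<epsilon> = 1")
    case True
    then show ?thesis using y(1) by (intro exI[of _ y]) simp
  next
    case False
    then have \<epsilon>: "\<epsilon> = -1" and eq: "?\<gamma> = shift_at E ends v \<gamma>" using assms(1) by simp_all
    show ?thesis unfolding eq unfolding \<epsilon> by (rule unshift_signing[OF y(1)])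
  qed
  then obtain x where x: "signing x"
    "\<And>u. imb x u = (if u = v then \<epsilon> else 1) * imbalance E ends ?\<gamma> y u" by blast
  \<comment> \<open>\<open>p\<close> and \<open>q\<close> are the shares of \<open>r\<close> and
    \<open>v\<close> in the merged imbalance \<open>j\<close>; the imbalance of \<open>v\<close>
    under \<open>\<gamma>\<close> is \<open>\<epsilon> * q\<close>.\<close>
  define p q where "p = imbalance E ends ?\<gamma> y r" and "q = imbalance E ends ?\<gamma> y v"
  have pq: "p + q = j"
    using imbalance_contract_root[of "{r, v}" r E ends ?\<gamma> y] y(2) assms(2)
    by (simp add: p_def q_def point_def)
  have off: "imbalance E ends ?\<gamma> y u = 0" if "u \<noteq> r" "u \<noteq> v" for u
    using imbalance_contract_outside[of u "{r, v}" r E ends ?\<gamma> y] y(2) that by (simp add: point_def)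
  have imbx: "imb x = (\<lambda>u. point r p u + point v (\<epsilon> * q) u)"
    using x(2) off assms(2) by (intro HOL.ext) (auto simp: p_def q_def point_def)
  then have fx: "feas (\<lambda>u. point r p u + point v (\<epsilon> * q) u)"
    using x(1) unfolding feasible_def by blast
  have "even (p - k)"
    using feas_diff_even[OF feas_root fx, of r] assms(2) by (simp add: point_def)
  then obtain i where "p - k = 2 * i" by (rule evenE)
  then have i: "p = k + 2 * i" by simp
  have "even q"
    using feas_diff_even[OF feas_root fx, of v] assms(1,2) by (auto simp: point_def)
  then obtain i' where i': "q = 2 * i'" by (rule evenE)
  have "i + i' \<le> 0"
    by (rule one_sided_critical_bound[OF assms(1-4)]) (use fx in \<open>simp add: i i' mult_ac\<close>)
  then show ?thesis using pq i i' by simp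
qed

end

section \<open>Existence of the maximal root imbalance\<close>

lemma imbalance_degree_even:
  assumes "finite E" "signing x"
  shows "even (imbalance E ends \<gamma> x v) \<longleftrightarrow> even (degree E ends v)"
proof -
  have "even (imbalance E ends \<gamma> x v - imbalance E ends (\<lambda>_. True) (\<lambda>_. 1) v)"
    unfolding imbalance_def sum_subtractf[symmetric]
  proof (rule dvd_sum)
    fix e
    have "x e = 1 \<or> x e = -1" using assms(2) by (auto simp: signing_def)
    then show "even (point (fst (ends e)) (x e) v + point (snd (ends e)) (if \<gamma> e then x e else - x e) v
      - (point (fst (ends e)) 1 v + point (snd (ends e)) (if True then 1 else - 1) v))"
      by (auto simp: point_def)
  qed
  then show ?thesis unfolding degree_eq_imbalance[OF assms(1), symmetric] by simp
qed

lemma imbalance_le: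
  assumes "signing x"
  shows "imbalance E ends \<gamma> x v \<le> 2 * int (card E)"
proof -
  have "imbalance E ends \<gamma> x v \<le> of_nat (card E) * 2"
    unfolding imbalance_def
  proof (rule sum_bounded_above)
    fix e
    have "x e = 1 \<or> x e = -1" using assms by (auto simp: signing_def)
    then show "point (fst (ends e)) (x e) v + point (snd (ends e)) (if \<gamma> e then x e else - x e) v \<le> 2"
      by (auto simp: point_def)
  qed
  then show ?thesis by simp
qed

text \<open>Negating all signs turns root imbalance \<open>j\<close> into \<open>- j\<close>, so the
  maximum is non-negative; it is even because \<open>b\<close> has even degree. Hence it has the
  form \<open>2 * int m\<close> with a natural number \<open>m\<close>.\<close>

lemma ex_maximum_root_imbalance:
  assumes "eulerian V E ends" "b \<in> V"
  obtains m :: nat where "feasible E ends \<gamma> (point b (2 * int m))"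
    "\<And>j. feasible E ends \<gamma> (point b j) \<Longrightarrow> j \<le> 2 * int m"
proof -
  have fin: "finite E" and deg: "even (degree E ends b)"
    using assms by (auto simp: eulerian_def graph_def)
  define S where "S = {j. feasible E ends \<gamma> (point b j)}"
  have neg: "- j \<in> S" if jS: "j \<in> S" for j
  proof -
    obtain x where x: "signing x" "imbalance E ends \<gamma> x = point b j"
      using jS unfolding S_def feasible_def by blast
    have "imbalance E ends \<gamma> (\<lambda>e. - x e) = point b (- j)"
      using x(2) by (intro HOL.ext) (simp add: imbalance_uminus point_def)
    moreover have "signing (\<lambda>e. - x e)" using x(1) by (fastforce simp: signing_def)
    ultimately show ?thesis unfolding S_def feasible_def by blast
  qed
  have bound: "j \<le> 2 * int (card E) \<and> even j" if jS: "j \<in> S" for j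
  proof -
    obtain x where x: "signing x" "imbalance E ends \<gamma> x = point b j"
      using jS unfolding S_def feasible_def by blast
    then have "imbalance E ends \<gamma> x b = j" by (simp add: point_def)
    then show ?thesis
      using imbalance_le[OF x(1), of E ends \<gamma> b] imbalance_degree_even[OF fin x(1), of ends \<gamma> b] deg
      by simp
  qed
  have "S \<subseteq> {- 2 * int (card E)..2 * int (card E)}"
    using bound bound[OF neg] by fastforce
  then have finS: "finite S" by (rule finite_subset) simp
  obtain x k where "signing x" "imbalance E ends \<gamma> x = point b k"
    using ex_balanced_signing[OF assms] by blast
  then have "k \<in> S" unfolding S_def feasible_def by blast
  then have ne: "S \<noteq> {}" by blast
  have M: "Max S \<in> S" using finS ne by (rule Max_in)
  have "- Max S \<le> Max S" by (rule Max_ge[OF finS neg[OF M]])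
  then have "0 \<le> Max S" by linarith
  moreover obtain q where "Max S = 2 * q"
    using bound[OF M] by (blast elim: evenE)
  ultimately have m: "Max S = 2 * int (nat q)" by simp
  show thesis
  proof (rule that)
    show "feasible E ends \<gamma> (point b (2 * int (nat q)))" using M m by (simp add: S_def)
    show "j \<le> 2 * int (nat q)" if "feasible E ends \<gamma> (point b j)" for j
      using that finS m[symmetric] by (simp add: S_def)
  qed
qed

section \<open>Both inequalities of the formula\<close>

lemma contracted_root_imbalance:
  assumes "graph V E ends" "X \<subseteq> V" "b \<in> X" "signing x"
    "imbalance E (contract X b ends) \<gamma> x = point b j"
  shows "j = (\<Sum>e\<in>{e \<in> E_in E ends X. \<gamma> e}. 2 * x e) + int (card (delta E ends X))
      - 2 * int (\<Sum>Y\<in>components_minus V E ends X. card (wrong_edges E ends \<gamma> x X \<inter> delta E ends Y))"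
    and "odd_components V E ends \<gamma> X = card {Y \<in> components_minus V E ends X.
      odd (card (wrong_edges E ends \<gamma> x X \<inter> delta E ends Y))}"
proof -
  have fin: "finite V" "finite E" using assms(1) by (auto simp: graph_def)
  have finX: "finite X" using assms(2) fin(1) by (rule finite_subset)
  have "j = imbalance E (contract X b ends) \<gamma> x b"
    using assms(5) by (simp add: point_def)
  also have "\<dots> = (\<Sum>v\<in>X. imbalance E ends \<gamma> x v)"
    by (rule imbalance_contract_root[OF finX assms(3)])
  finally show "j = (\<Sum>e\<in>{e \<in> E_in E ends X. \<gamma> e}. 2 * x e) + int (card (delta E ends X))
      - 2 * int (\<Sum>Y\<in>components_minus V E ends X. card (wrong_edges E ends \<gamma> x X \<inter> delta E ends Y))"
    unfolding sum_imbalance_boundary[OF fin(2) finX assms(4)] card_wrong_edges[OF assms(1)] .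
  have "odd (card (wrong_edges E ends \<gamma> x X \<inter> delta E ends Y)) \<longleftrightarrow> gamma_odd E ends \<gamma> Y"
    if Y: "Y \<in> components_minus V E ends X" for Y
  proof (rule wrong_edges_parity[OF fin(2) _ assms(4) _ delta_component_subset[OF assms(1) Y]])
    have YV: "Y \<subseteq> V - X" by (rule components_minus_subset[OF Y])
    then show "finite Y" "Y \<inter> X = {}" using fin(1) by (auto intro: finite_subset)
    show "imbalance E ends \<gamma> x v = 0" if "v \<in> Y" for v
    proof -
      have "v \<notin> X" "v \<noteq> b" using that YV assms(3) by blast+
      then show ?thesis
        using imbalance_contract_outside[of v X b E ends \<gamma> x] assms(3,5) by (simp add: point_def)
    qed
  qed
  then have "{Y \<in> components_minus V E ends X. gamma_odd E ends \<gamma> Y} =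
      {Y \<in> components_minus V E ends X. odd (card (wrong_edges E ends \<gamma> x X \<inter> delta E ends Y))}"
    by blast
  then show "odd_components V E ends \<gamma> X = card {Y \<in> components_minus V E ends X.
      odd (card (wrong_edges E ends \<gamma> x X \<inter> delta E ends Y))}"
    by (simp only: odd_components_def)
qed

lemma card_odd_le_sum:
  fixes f :: "'a \<Rightarrow> nat"
  assumes "finite A"
  shows "card {a \<in> A. odd (f a)} \<le> sum f A"
    and "(\<And>a. a \<in> A \<Longrightarrow> f a \<le> 1) \<Longrightarrow> card {a \<in> A. odd (f a)} = sum f A"
proof -
  have c: "card {a \<in> A. odd (f a)} = (\<Sum>a\<in>A. if odd (f a) then 1 else 0)"
    using assms by (simp add: sum.If_cases Int_def)
  show "card {a \<in> A. odd (f a)} \<le> sum f A"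
    unfolding c by (rule sum_mono) (auto elim: oddE)
  show "card {a \<in> A. odd (f a)} = sum f A" if "\<And>a. a \<in> A \<Longrightarrow> f a \<le> 1"
    unfolding c
  proof (rule sum.cong[OF HOL.refl])
    fix a assume "a \<in> A"
    then have "f a = 0 \<or> f a = 1" using that[of a] by linarith
    then show "(if odd (f a) then 1 else 0) = f a" by auto
  qed
qed

lemma finite_components_minus: "graph V E ends \<Longrightarrow> finite (components_minus V E ends X)"
  by (simp add: graph_def components_minus_def)

text \<open>Two estimates of the contracted root imbalance: signs inside \<open>X\<close> are at
  most 1, and every odd component has an odd number of wrong edges, hence at least one.\<close>

lemma root_imbalance_le:
  assumes "graph V E ends" "X \<subseteq> V" "b \<in> X" "feasible E (contract X b ends) \<gamma> (point b (2 * int m))"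
  shows "int m \<le> int (wcount \<gamma> (E_in E ends X)) + int (card (delta E ends X) div 2)
    - int (odd_components V E ends \<gamma> X)"
proof -
  obtain x where x: "signing x" "imbalance E (contract X b ends) \<gamma> x = point b (2 * int m)"
    using assms(4) unfolding feasible_def by blast
  define N where "N = (\<Sum>Y\<in>components_minus V E ends X. card (wrong_edges E ends \<gamma> x X \<inter> delta E ends Y))"
  define S where "S = (\<Sum>e\<in>{e \<in> E_in E ends X. \<gamma> e}. x e)"
  have eq: "2 * int m = 2 * S + int (card (delta E ends X)) - 2 * int N"
    unfolding N_def S_def sum_distrib_left by (rule contracted_root_imbalance(1)[OF assms(1-3) x])
  have "odd_components V E ends \<gamma> X \<le> N"
    unfolding contracted_root_imbalance(2)[OF assms(1-3) x] N_def
    by (rule card_odd_le_sum(1)[OF finite_components_minus[OF assms(1)]])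
  moreover have "S \<le> of_nat (card {e \<in> E_in E ends X. \<gamma> e}) * 1"
    unfolding S_def
  proof (rule sum_bounded_above)
    show "x e \<le> 1" for e
      using x(1) unfolding signing_def by (elim allE[of _ e]) auto
  qed
  ultimately show ?thesis
    using eq unfolding wcount_def by linarith
qed

text \<open>The two assumptions on \<open>x\<close> turn both estimates of
  \<open>root_imbalance_le\<close> into equalities: a number that is at most 1 equals its
  parity.\<close>

lemma root_imbalance_eq:
  assumes "graph V E ends" "X \<subseteq> V" "b \<in> X"
    and x: "signing x" "imbalance E (contract X b ends) \<gamma> x = point b (2 * int m)"
    and inner: "\<And>e. e \<in> E_in E ends X \<Longrightarrow> \<gamma> e \<Longrightarrow> x e = 1"
    and wrong: "\<And>Y. Y \<in> components_minus V E ends X \<Longrightarrow>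
      card (wrong_edges E ends \<gamma> x X \<inter> delta E ends Y) \<le> 1"
  shows "int m = int (wcount \<gamma> (E_in E ends X)) + int (card (delta E ends X) div 2)
    - int (odd_components V E ends \<gamma> X)"
proof -
  define N where "N = (\<Sum>Y\<in>components_minus V E ends X. card (wrong_edges E ends \<gamma> x X \<inter> delta E ends Y))"
  have "2 * int m = (\<Sum>e\<in>{e \<in> E_in E ends X. \<gamma> e}. 2 * x e) + int (card (delta E ends X)) - 2 * int N"
    unfolding N_def by (rule contracted_root_imbalance(1)[OF assms(1-3) x])
  also have "(\<Sum>e\<in>{e \<in> E_in E ends X. \<gamma> e}. 2 * x e) = (\<Sum>e\<in>{e \<in> E_in E ends X. \<gamma> e}. 2)"
    by (rule sum.cong) (use inner in auto)
  also have "\<dots> = 2 * int (wcount \<gamma> (E_in E ends X))"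
    by (simp add: wcount_def)
  finally have eq: "2 * int m = 2 * int (wcount \<gamma> (E_in E ends X)) + int (card (delta E ends X)) - 2 * int N" .
  have "odd_components V E ends \<gamma> X = N"
    unfolding contracted_root_imbalance(2)[OF assms(1-3) x] N_def
    by (rule card_odd_le_sum(2)[OF finite_components_minus[OF assms(1)] wrong])
  then show ?thesis using eq by linarith
qed

lemma wrong_edge_arc:
  assumes "e \<in> wrong_edges E ends \<gamma> x X" "b \<in> X" "e \<in> delta E ends Y" "Y \<inter> X = {}"
  shows "\<exists>a. fst a = e \<and> e \<in> E \<and> arc_tail (contract X b ends) a = b \<and> tail_sign \<gamma> x a = -1 \<and>
    arc_head (contract X b ends) a \<in> Y"
proof -
  have e: "e \<in> E" "(fst (ends e) \<in> X) \<noteq> (snd (ends e) \<in> X)"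
    "(fst (ends e) \<in> Y) \<noteq> (snd (ends e) \<in> Y)" "boundary_sign ends \<gamma> x X e = -1"
    using assms(1,3) by (auto simp: wrong_edges_def delta_def)
  define a where "a = (e, fst (ends e) \<in> X)"
  have "tail_sign \<gamma> x a = -1"
    using e(4) by (auto simp: a_def tail_sign_def boundary_sign_def split: if_splits)
  moreover have "arc_tail (contract X b ends) a = b"
    using e(2) by (auto simp: a_def arc_tail_def contract_def)
  moreover have "arc_head (contract X b ends) a \<in> Y"
    using e(2,3) assms(4) by (auto simp: a_def arc_head_def contract_def)
  ultimately show ?thesis using e(1) by (intro exI[of _ a]) (simp add: a_def)
qed

lemma ex_tight_certificate:
  assumes "eulerian V E ends" "b \<in> V"
    and max: "feasible E ends \<gamma> (point b (2 * int m))"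
      "\<And>j. feasible E ends \<gamma> (point b j) \<Longrightarrow> j \<le> 2 * int m"
  shows "\<exists>\<gamma>' X. is_shifting V E ends \<gamma> \<gamma>' \<and> X \<subseteq> V \<and> b \<in> X \<and>
    int m = int (wcount \<gamma>' (E_in E ends X)) + int (card (delta E ends X) div 2)
           - int (odd_components V E ends \<gamma>' X)"
proof -
  have G: "graph V E ends" and fin: "finite V" "finite E"
    using assms(1) by (auto simp: eulerian_def graph_def)
  \<comment> \<open>\<open>(\<gamma>, {b})\<close> qualifies because contracting \<open>{b}\<close>
    changes nothing, and \<open>card V\<close> bounds the size of the sets; so a pair with largest
    \<open>X\<close> exists.\<close>
  define P where "P p \<longleftrightarrow> is_shifting V E ends \<gamma> (fst p) \<and> snd p \<subseteq> V \<and> b \<in> snd p \<and>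
    (\<forall>j. feasible E (contract (snd p) b ends) (fst p) (point b j) \<longrightarrow> j \<le> 2 * int m)" for p
  have P0: "P (\<gamma>, {b})"
    using assms(2) max(2) by (simp add: P_def is_shifting.refl contract_root)
  have "\<forall>p. P p \<longrightarrow> card (snd p) < Suc (card V)"
    using card_mono[OF fin(1)] by (auto simp: P_def less_Suc_eq_le)
  then have "\<exists>p. P p \<and> (\<forall>q. P q \<longrightarrow> card (snd q) \<le> card (snd p))"
    by (rule ex_has_greatest_nat[where P = P and f = "\<lambda>p. card (snd p)", OF P0])
  then obtain p where p: "P p" "\<And>q. P q \<Longrightarrow> card (snd q) \<le> card (snd p)"
    by blast
  obtain \<gamma>' X where [simp]: "p = (\<gamma>', X)" by (cases p)
  let ?H = "contract X b ends"
  have sh: "is_shifting V E ends \<gamma> \<gamma>'" and X: "X \<subseteq> V" "b \<in> X"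
    and top: "\<And>j. feasible E ?H \<gamma>' (point b j) \<Longrightarrow> j \<le> 2 * int m"
    using p(1) by (auto simp: P_def)
  have finX: "finite X" using X(1) fin(1) by (rule finite_subset)
  have feas: "feasible E ?H \<gamma>' (point b (2 * int m))"
    by (rule feasible_contract[OF finX X(2) feasible_shifting[OF sh max(1)]])
  interpret H: rooted_signed_graph E ?H \<gamma>' b "2 * int m"
    by unfold_locales (fact fin(2), fact feas, fact top)
  \<comment> \<open>A vertex critical for one sign only could be added to \<open>X\<close>, against
    the choice of \<open>X\<close>.\<close>
  have bic: "H.bicritical v"
    if v: "v \<in> V - X" "\<tau> = 1 \<or> \<tau> = -1" "H.critical v \<tau>" for v \<tau>
  proof -
    have vb: "v \<noteq> b" using v(1) X(2) by blast
    have "H.critical v (- \<tau>)"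
    proof (rule ccontr)
      assume no: "\<not> H.critical v (- \<tau>)"
      have pm: "- \<tau> = 1 \<or> - \<tau> = -1" using v(2) by linarith
      have crit: "H.critical v (- (- \<tau>))" using v(3) by simp
      \<comment> \<open>\<open>- \<tau>\<close> plays the part of \<open>\<epsilon>\<close> in
        \<open>merge_one_sided_critical\<close>: a vertex paying with \<open>-1\<close> is merged as
        it is, one paying with \<open>1\<close> is shifted first.\<close>
      define \<gamma>'' where "\<gamma>'' = (if - \<tau> = 1 then \<gamma>' else shift_at E ends v \<gamma>')"
      have s2: "is_shifting V E ends \<gamma> \<gamma>''"
        using sh is_shifting.step[OF sh, of v] v(1) by (simp add: \<gamma>''_def)
      have eq: "\<gamma>'' = (if - \<tau> = 1 then \<gamma>' else shift_at E ?H v \<gamma>')"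
        using shift_at_contract[of v X b E ends \<gamma>'] v(1) X(2) by (simp add: \<gamma>''_def)
      have "j \<le> 2 * int m" if "feasible E (contract (insert v X) b ends) \<gamma>'' (point b j)" for j
        using H.merge_one_sided_critical[OF pm vb crit no, of j] that
        unfolding contract_insert[OF X(2)] eq by simp
      then have "P (\<gamma>'', insert v X)"
        using s2 v(1) X by (simp add: P_def)
      then show False using p(2)[of "(\<gamma>'', insert v X)"] finX v(1) by simp
    qed
    then show ?thesis using v(2,3) vb by (auto simp: H.bicritical_def)
  qed
  obtain x where x: "signing x" "imbalance E ?H \<gamma>' x = point b (2 * int m)"
    using feas unfolding feasible_def by blast
  have "int m = int (wcount \<gamma>' (E_in E ends X)) + int (card (delta E ends X) div 2)
           - int (odd_components V E ends \<gamma>' X)"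
  proof (rule root_imbalance_eq[OF G X x])
    show "x e = 1" if "e \<in> E_in E ends X" "\<gamma>' e" for e
      by (rule H.root_loop_positive[OF x]) (use that in \<open>auto simp: E_in_def contract_def\<close>)
    show "card (wrong_edges E ends \<gamma>' x X \<inter> delta E ends Y) \<le> 1"
      if Y: "Y \<in> components_minus V E ends X" for Y
    proof -
      have YX: "Y \<inter> X = {}" "Y \<subseteq> V - X" using components_minus_subset[OF Y] by blast+
      have unique: "e = e'" if e: "e \<in> wrong_edges E ends \<gamma>' x X \<inter> delta E ends Y"
        "e' \<in> wrong_edges E ends \<gamma>' x X \<inter> delta E ends Y" for e e'
      proof -
        obtain a where a: "fst a = e" "fst a \<in> E" "arc_tail ?H a = b" "tail_sign \<gamma>' x a = -1"
          "arc_head ?H a \<in> Y"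
          using wrong_edge_arc[of e E ends \<gamma>' x X b Y] e(1) X(2) YX(1) by auto
        obtain a' where a': "fst a' = e'" "fst a' \<in> E" "arc_tail ?H a' = b" "tail_sign \<gamma>' x a' = -1"
          "arc_head ?H a' \<in> Y"
          using wrong_edge_arc[of e' E ends \<gamma>' x X b Y] e(2) X(2) YX(1) by auto
        have "(arc_head ?H a, arc_head ?H a') \<in> (adj_in (V - X) E ?H)\<^sup>*"
          using components_minus_connected[OF Y a(5)] a'(5) X(2)
          by (subst adj_in_contract) auto
        then have "fst a = fst a'"
          using a a' YX(2) X(2) bic
          by (intro H.wrong_arcs_same_component[OF _ _ x, of "V - X"]) auto
        then show ?thesis using a(1) a'(1) by simp
      qed
      have "finite (wrong_edges E ends \<gamma>' x X \<inter> delta E ends Y)"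
        using fin(2) by (simp add: delta_def)
      then have "card (wrong_edges E ends \<gamma>' x X \<inter> delta E ends Y) \<le> Suc 0"
        using unique by (subst card_le_Suc0_iff_eq) blast+
      then show ?thesis by simp
    qed
  qed
  then show ?thesis using sh X by blast
qed

theorem mainTheorem1:
  fixes V :: "'v set" and E :: "'e set" and ends :: "'e \<Rightarrow> 'v \<times> 'v"
    and \<gamma> :: "'e \<Rightarrow> bool" and b :: 'v
  assumes "eulerian V E ends" and "b \<in> V"
  shows "int (flooding_number V E ends \<gamma> b) =
    Min {int (wcount \<gamma>' (E_in E ends X)) + int (card (delta E ends X) div 2)
           - int (odd_components V E ends \<gamma>' X)
         | \<gamma>' X. is_shifting V E ends \<gamma> \<gamma>' \<and> X \<subseteq> V \<and> b \<in> X}"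
proof -
  have G: "graph V E ends" and fin: "finite V" "finite E"
    using assms(1) by (auto simp: eulerian_def graph_def)
  obtain m where m: "feasible E ends \<gamma> (point b (2 * int m))"
    "\<And>j. feasible E ends \<gamma> (point b j) \<Longrightarrow> j \<le> 2 * int m"
    using ex_maximum_root_imbalance[OF assms] by blast
  let ?f = "\<lambda>\<gamma>' X. int (wcount \<gamma>' (E_in E ends X)) + int (card (delta E ends X) div 2)
           - int (odd_components V E ends \<gamma>' X)"
  let ?A = "{?f \<gamma>' X | \<gamma>' X. is_shifting V E ends \<gamma> \<gamma>' \<and> X \<subseteq> V \<and> b \<in> X}"
  have flood: "flooding_number V E ends \<gamma> b = m"
  proof -
    obtain x where x: "signing x" "imbalance E ends \<gamma> x = point b (2 * int m)"
      using m(1) unfolding feasible_def by blast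
    show ?thesis
      by (rule flooding_number_eq[OF assms x]) (use m(2) in \<open>auto simp: feasible_def\<close>)
  qed
  have lower: "int m \<le> ?f \<gamma>' X" if "is_shifting V E ends \<gamma> \<gamma>'" "X \<subseteq> V" "b \<in> X" for \<gamma>' X
    by (rule root_imbalance_le[OF G that(2,3)
          feasible_contract[OF finite_subset[OF that(2) fin(1)] that(3) feasible_shifting[OF that(1) m(1)]]])
  \<comment> \<open>A crude bound whose purpose is to make the set of values finite, so that
    \<open>Min\<close> is attained.\<close>
  have upper: "?f \<gamma>' X \<le> 2 * int (card E)" for \<gamma>' X
  proof -
    have "wcount \<gamma>' (E_in E ends X) \<le> card E" "card (delta E ends X) \<le> card E"
      using fin(2) by (auto simp: wcount_def E_in_def delta_def intro!: card_mono)
    then show ?thesis by linarith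
  qed
  have "?A \<subseteq> {int m..2 * int (card E)}"
    using lower upper by auto
  then have "finite ?A" by (rule finite_subset) simp
  moreover have "int m \<in> ?A"
  proof -
    obtain \<gamma>' X where "is_shifting V E ends \<gamma> \<gamma>'" "X \<subseteq> V" "b \<in> X" "int m = ?f \<gamma>' X"
      using ex_tight_certificate[OF assms m] by blast
    then show ?thesis by blast
  qed
  ultimately have "Min ?A = int m"
    using lower by (intro Min_eqI) auto
  then show ?thesis unfolding flood by simp
qed

end
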